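(* For every integer $s\geq 1$ and every constant $C>0$ there is an $n_0=n_0(s,C)$ with the following property. If $G$ is a $(2s-1)$-leveled graph with $n\geq n_0$ vertices and with $k_{s+1}(G)\leq Cn^s$, then $$|E(G)|\leq \frac{s-1}{2s}n^2+n.$$
   Context: All graphs are finite and simple. $k_r(G)$ denotes the number of cliques with $r$ vertices in $G$. For a clique $\sigma$ in $G$, the link $\mathrm{lk}_G\sigma$ is the subgraph of $G$ induced on the set of vertices adjacent to every vertex of $\sigma$. For an integer $d\geq 0$, a graph $G$ is called $d$-leveled if (i) every maximal clique of $G$ has exactly $d+1$ vertices, and (ii) for every clique $\sigma$ with $d$ vertices, $\mathrm{lk}_G\sigma$ consists of exactly two vertices with no edge between them. (Equivalently, $G$ is the $1$-skeleton of a $d$-dimensional flag weak pseudomanifold.) *)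

theory Defs
  imports Complex_Main "HOL-Library.Ramsey"
begin

text \<open>A finite simple graph is a pair of a finite vertex set \<open>V\<close> and a set \<open>E\<close> of
  two-element subsets of \<open>V\<close>. The predicate \<^const>\<open>clique\<close> from the library does not
  require its argument to consist of vertices of the graph; \<open>cliques\<close> below adds this.\<close>

definition fin_simple_graph :: "'a set \<Rightarrow> 'a set set \<Rightarrow> bool" where
  "fin_simple_graph V E \<longleftrightarrow> finite V \<and> E \<subseteq> [V]\<^bsup>2\<^esup>"

definition cliques :: "'a set \<Rightarrow> 'a set set \<Rightarrow> 'a set set" where
  "cliques V E = {K. K \<subseteq> V \<and> clique K E}"

definition num_cliques :: "nat \<Rightarrow> 'a set \<Rightarrow> 'a set set \<Rightarrow> nat" where
  "num_cliques r V E = card {K \<in> cliques V E. card K = r}"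

definition maximal_clique :: "'a set \<Rightarrow> 'a set set \<Rightarrow> 'a set \<Rightarrow> bool" where
  "maximal_clique V E K \<longleftrightarrow>
     K \<in> cliques V E \<and> (\<forall>L \<in> cliques V E. K \<subseteq> L \<longrightarrow> L = K)"

definition link_verts :: "'a set \<Rightarrow> 'a set set \<Rightarrow> 'a set \<Rightarrow> 'a set" where
  "link_verts V E \<sigma> = {v \<in> V. \<forall>u \<in> \<sigma>. {u, v} \<in> E}"

definition link_edges :: "'a set \<Rightarrow> 'a set set \<Rightarrow> 'a set \<Rightarrow> 'a set set" where
  "link_edges V E \<sigma> = {e \<in> E. e \<subseteq> link_verts V E \<sigma>}"

text \<open>The empty set is a clique with 0 vertices and its link is the whole graph, so
  for \<open>d = 0\<close> the second condition says that the graph consists of two isolated vertices.\<close>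

definition leveled :: "nat \<Rightarrow> 'a set \<Rightarrow> 'a set set \<Rightarrow> bool" where
  "leveled d V E \<longleftrightarrow>
     (\<forall>K. maximal_clique V E K \<longrightarrow> card K = d + 1) \<and>
     (\<forall>\<sigma> \<in> cliques V E. card \<sigma> = d \<longrightarrow>
        card (link_verts V E \<sigma>) = 2 \<and> link_edges V E \<sigma> = {})"

end

theory Submission
  imports Defs "HOL-Analysis.Convex"
begin

text \<open>Suppose \<open>G\<close> has at least the edge density of the \<open>s\<close>-partite Turan graph. By the Moon--Moser
  inequalities there are \<open>\<Theta>(n\<^sup>s)\<close> cliques with \<open>s\<close> vertices, so an average one extends to only
  \<open>O(1)\<close> cliques with \<open>s + 1\<close> vertices. Sorting the vertices by which vertex of such a clique
  they miss gives an \<open>s\<close>-colouring in which all but \<open>O(n)\<close> of the pairs are adjacent exactly when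
  their colours differ; we take one with the fewest monochromatic edges.

  A ridge lies in just two facets, so a bounded set of vertices spans boundedly many facets.
  This allows one to replace the vertices of a transversal clique, colour by colour, by pairs of adjacent
  vertices of the same colour. Inside the link of a vertex with many neighbours in all parts the
  result would be a clique with \<open>2s + 1\<close> vertices; hence every vertex has at most \<open>\<delta>n\<close> neighbours in
  its own part. In the whole graph it gives cliques \<open>T\<close> with \<open>2s - 2\<close> vertices outside part \<open>j\<close>, whose
  links are 2-regular. With \<open>M\<close> non-adjacent pairs between the parts, averaging yields such a \<open>T\<close> whose
  link misses only \<open>O(M/n)\<close> vertices of part \<open>j\<close>. So the parts contain at most
  \<open>n + O(\<delta>M) \<le> n + M\<close> edges, and the \<open>M\<close> missing edges compensate the excess.\<close>

section \<open>Clique counts and near-Turan colourings\<close>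

locale finite_graph =
  fixes V :: "'a set" and E :: "'a set set"
  assumes fin_simple_graph: "fin_simple_graph V E"
begin

abbreviation link where "link \<equiv> link_verts V E"

definition rcliques :: "nat \<Rightarrow> 'a set set" where
  "rcliques r = {K \<in> cliques V E. card K = r}"

section \<open>Basic facts about links and cliques\<close>

lemma finite_V [simp, intro]: "finite V"
  using fin_simple_graph by (simp add: fin_simple_graph_def)

lemma edge_in_V: "{u, v} \<in> E \<Longrightarrow> u \<in> V \<and> v \<in> V \<and> u \<noteq> v"
proof -
  assume "{u, v} \<in> E"
  then have "{u, v} \<in> [V]\<^bsup>2\<^esup>"
    using fin_simple_graph unfolding fin_simple_graph_def by blast
  then show ?thesis by simp
qed

lemma not_loop [simp]: "{u} \<notin> E"
  using edge_in_V[of u u] by auto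

lemma link_subset: "link \<sigma> \<subseteq> V"
  by (auto simp: link_verts_def)

lemma finite_link [simp, intro]: "finite (link \<sigma>)"
  by (rule finite_subset[OF link_subset]) simp

lemma link_insert: "link (insert u \<sigma>) = {v \<in> link \<sigma>. {u, v} \<in> E}"
  by (auto simp: link_verts_def)

lemma link_antimono: "\<sigma> \<subseteq> \<tau> \<Longrightarrow> link \<tau> \<subseteq> link \<sigma>"
  by (auto simp: link_verts_def)

lemma clique_subset_V: "\<sigma> \<in> cliques V E \<Longrightarrow> \<sigma> \<subseteq> V"
  by (simp add: cliques_def)

lemma finite_clique: "\<sigma> \<in> cliques V E \<Longrightarrow> finite \<sigma>"
  by (rule finite_subset[OF clique_subset_V]) simp_all

lemma finite_cliques [simp, intro]: "finite (cliques V E)"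
  by (rule finite_subset[of _ "Pow V"]) (auto simp: cliques_def)

lemma finite_rcliques [simp, intro]: "finite (rcliques r)"
  by (simp add: rcliques_def)

lemma clique_mono: "\<sigma> \<in> cliques V E \<Longrightarrow> \<tau> \<subseteq> \<sigma> \<Longrightarrow> \<tau> \<in> cliques V E"
  by (auto simp: cliques_def clique_def)

lemma link_not_mem: "v \<in> link \<sigma> \<Longrightarrow> v \<notin> \<sigma>"
  by (auto simp: link_verts_def)

lemma insert_clique: "\<sigma> \<in> cliques V E \<Longrightarrow> v \<in> link \<sigma> \<Longrightarrow> insert v \<sigma> \<in> cliques V E"
  by (auto simp: cliques_def clique_def link_verts_def insert_commute)

lemma clique_edge: "\<sigma> \<in> cliques V E \<Longrightarrow> u \<in> \<sigma> \<Longrightarrow> v \<in> \<sigma> \<Longrightarrow> u \<noteq> v \<Longrightarrow> {u, v} \<in> E"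
  by (auto simp: cliques_def clique_def)

lemma mem_link_remove: "\<sigma> \<in> cliques V E \<Longrightarrow> u \<in> \<sigma> \<Longrightarrow> u \<in> link (\<sigma> - {u})"
  by (auto simp: cliques_def clique_def link_verts_def)

lemma empty_clique [simp]: "{} \<in> cliques V E"
  by (simp add: cliques_def)

lemma singleton_clique: "v \<in> V \<Longrightarrow> {v} \<in> cliques V E"
  by (simp add: cliques_def clique_def)

lemma link_empty [simp]: "link {} = V"
  by (simp add: link_verts_def)

section \<open>Double counting of cliques and the Moon-Moser inequality\<close>

text \<open>Adding the vertex to the clique is a bijection from pairs (\<open>r\<close>-clique,
  vertex of its link) to \<open>(r + 1)\<close>-cliques with a marked vertex.\<close>

lemma sum_rcliques_link:
  fixes f :: "'a set \<Rightarrow> 'a \<Rightarrow> 'b::comm_monoid_add"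
  shows "(\<Sum>\<tau>\<in>rcliques r. \<Sum>v\<in>link \<tau>. f \<tau> v)
       = (\<Sum>\<sigma>\<in>rcliques (Suc r). \<Sum>u\<in>\<sigma>. f (\<sigma> - {u}) u)"
proof -
  have "(\<Sum>\<tau>\<in>rcliques r. \<Sum>v\<in>link \<tau>. f \<tau> v)
      = (\<Sum>(\<tau>, v)\<in>(SIGMA \<tau>:rcliques r. link \<tau>). f \<tau> v)"
    by (rule sum.Sigma) auto
  also have "\<dots> = (\<Sum>(\<sigma>, u)\<in>(SIGMA \<sigma>:rcliques (Suc r). \<sigma>). f (\<sigma> - {u}) u)"
  proof (rule sum.reindex_bij_witness[where i = "\<lambda>(\<sigma>, u). (\<sigma> - {u}, u)"
        and j = "\<lambda>(\<tau>, v). (insert v \<tau>, v)"], goal_cases)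
    case (1 a)
    then show ?case by (auto dest: link_not_mem)
  next
    case (2 a)
    then show ?case
      by (auto simp: rcliques_def insert_clique link_not_mem finite_clique)
  next
    case (3 b)
    then show ?case by auto
  next
    case (4 b)
    then show ?case
      by (auto simp: rcliques_def mem_link_remove dest: finite_clique intro: clique_mono)
  next
    case (5 a)
    then show ?case by (auto dest: link_not_mem)
  qed
  also have "\<dots> = (\<Sum>\<sigma>\<in>rcliques (Suc r). \<Sum>u\<in>\<sigma>. f (\<sigma> - {u}) u)"
    by (rule sum.Sigma[symmetric]) (auto simp: rcliques_def dest: finite_clique)
  finally show ?thesis .
qed

lemma sum_card_link: "(\<Sum>\<tau>\<in>rcliques r. card (link \<tau>)) = Suc r * card (rcliques (Suc r))"
proof -
  have "(\<Sum>\<tau>\<in>rcliques r. card (link \<tau>)) = (\<Sum>\<sigma>\<in>rcliques (Suc r). \<Sum>u\<in>\<sigma>. 1)"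
    using sum_rcliques_link[of "\<lambda>_ _. 1::nat" r] by simp
  also have "\<dots> = (\<Sum>\<sigma>\<in>rcliques (Suc r). Suc r)"
    by (rule sum.cong) (auto simp: rcliques_def)
  finally show ?thesis by simp
qed

text \<open>For nonempty \<open>\<sigma>\<close> these are the vertices non-adjacent to at least two
  vertices of \<open>\<sigma>\<close>, where a vertex of \<open>\<sigma>\<close> counts as
  non-adjacent to itself.\<close>

definition unassigned :: "'a set \<Rightarrow> 'a set" where
  "unassigned \<sigma> = V - (\<Union>u\<in>\<sigma>. link (\<sigma> - {u}))"

text \<open>Compare contributions vertex by vertex: a vertex of \<open>link \<sigma>\<close> lies in
  all \<open>r + 1\<close> links on the left, any other vertex in at most one, and an unassigned
  vertex in none.\<close>

lemma sum_link_remove_le: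
  assumes "\<sigma> \<in> rcliques (Suc r)"
  shows "(\<Sum>u\<in>\<sigma>. card (link (\<sigma> - {u}))) + card (unassigned \<sigma>) \<le> card V + r * card (link \<sigma>)"
proof -
  have fs: "finite \<sigma>" and cs: "card \<sigma> = Suc r"
    using assms by (auto simp: rcliques_def dest: finite_clique)
  have "(\<Sum>u\<in>\<sigma>. card (link (\<sigma> - {u}))) = (\<Sum>u\<in>\<sigma>. \<Sum>v\<in>V. of_bool (v \<in> link (\<sigma> - {u})))"
    by (intro sum.cong refl) (simp add: Int_absorb1[OF link_subset] Collect_mem_eq)
  also have "\<dots> = (\<Sum>v\<in>V. \<Sum>u\<in>\<sigma>. of_bool (v \<in> link (\<sigma> - {u})))"
    by (rule sum.swap)
  also have "\<dots> = (\<Sum>v\<in>V. card {u \<in> \<sigma>. v \<in> link (\<sigma> - {u})})"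
    by (intro sum.cong refl) (simp add: fs Collect_conj_eq)
  finally have 1: "(\<Sum>u\<in>\<sigma>. card (link (\<sigma> - {u}))) = (\<Sum>v\<in>V. card {u \<in> \<sigma>. v \<in> link (\<sigma> - {u})})" .
  have "unassigned \<sigma> \<subseteq> V" by (auto simp: unassigned_def)
  then have 2: "card (unassigned \<sigma>) = (\<Sum>v\<in>V. of_bool (v \<in> unassigned \<sigma>))"
    by (simp add: Int_absorb1 Collect_mem_eq)
  have 3: "card (link \<sigma>) = (\<Sum>v\<in>V. of_bool (v \<in> link \<sigma>))"
    by (simp add: Int_absorb1[OF link_subset] Collect_mem_eq)
  have "card {u \<in> \<sigma>. v \<in> link (\<sigma> - {u})} + of_bool (v \<in> unassigned \<sigma>)
      \<le> 1 + r * of_bool (v \<in> link \<sigma>)" if "v \<in> V" for v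
  proof (cases "v \<in> link \<sigma>")
    case True
    have "v \<notin> unassigned \<sigma>"
    proof -
      obtain u where "u \<in> \<sigma>" using cs by fastforce
      then show ?thesis
        using True link_antimono[of "\<sigma> - {u}" \<sigma>] by (auto simp: unassigned_def)
    qed
    moreover have "card {u \<in> \<sigma>. v \<in> link (\<sigma> - {u})} \<le> card \<sigma>"
      by (rule card_mono) (auto simp: fs)
    ultimately show ?thesis using True cs by simp
  next
    case False
    have "u = w" if "u \<in> \<sigma>" "w \<in> \<sigma>" "v \<in> link (\<sigma> - {u})" "v \<in> link (\<sigma> - {w})" for u w
      using False that by (auto simp: link_verts_def)
    then have "card {u \<in> \<sigma>. v \<in> link (\<sigma> - {u})} \<le> 1"
      using fs by (subst card_le_Suc0_iff_eq[unfolded One_nat_def[symmetric]]) auto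
    moreover have "card {u \<in> \<sigma>. v \<in> link (\<sigma> - {u})} = 0" if "v \<in> unassigned \<sigma>"
      using that by (auto simp: unassigned_def card_eq_0_iff)
    ultimately show ?thesis by (cases "v \<in> unassigned \<sigma>") simp_all
  qed
  then have "(\<Sum>v\<in>V. card {u \<in> \<sigma>. v \<in> link (\<sigma> - {u})} + of_bool (v \<in> unassigned \<sigma>))
      \<le> (\<Sum>v\<in>V. 1 + r * of_bool (v \<in> link \<sigma>))"
    by (rule sum_mono)
  then show ?thesis
    unfolding 1 2 3 by (simp only: sum.distrib sum_distrib_left) simp
qed

text \<open>Without the unassigned vertices this is half of the Moon-Moser argument. Keeping them
  makes it a stability statement: near equality forces most vertices to miss at most one vertex of a
  typical clique.\<close>

lemma sum_card_link_sq_le: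
  "(\<Sum>\<tau>\<in>rcliques r. (card (link \<tau>))\<^sup>2) + (\<Sum>\<sigma>\<in>rcliques (Suc r). card (unassigned \<sigma>))
   \<le> card V * card (rcliques (Suc r)) + r * (r + 2) * card (rcliques (r + 2))"
proof -
  have "(\<Sum>\<tau>\<in>rcliques r. (card (link \<tau>))\<^sup>2)
      = (\<Sum>\<sigma>\<in>rcliques (Suc r). \<Sum>u\<in>\<sigma>. card (link (\<sigma> - {u})))"
    using sum_rcliques_link[of "\<lambda>\<tau> _. card (link \<tau>)" r] by (simp add: power2_eq_square)
  then have "(\<Sum>\<tau>\<in>rcliques r. (card (link \<tau>))\<^sup>2) + (\<Sum>\<sigma>\<in>rcliques (Suc r). card (unassigned \<sigma>))
      = (\<Sum>\<sigma>\<in>rcliques (Suc r). (\<Sum>u\<in>\<sigma>. card (link (\<sigma> - {u}))) + card (unassigned \<sigma>))"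
    by (simp add: sum.distrib)
  also have "\<dots> \<le> (\<Sum>\<sigma>\<in>rcliques (Suc r). card V + r * card (link \<sigma>))"
    by (intro sum_mono sum_link_remove_le)
  also have "\<dots> = card V * card (rcliques (Suc r)) + r * (\<Sum>\<sigma>\<in>rcliques (Suc r). card (link \<sigma>))"
    by (simp add: sum.distrib sum_distrib_left)
  finally show ?thesis by (simp add: sum_card_link algebra_simps)
qed

text \<open>Cauchy-Schwarz for the link sizes, whose sum is given by
  \<open>sum_card_link\<close>.\<close>

lemma card_rcliques_sq_le:
  "(Suc r * card (rcliques (Suc r)))\<^sup>2 \<le> card (rcliques r) * (\<Sum>\<tau>\<in>rcliques r. (card (link \<tau>))\<^sup>2)"
proof -
  have "(\<Sum>\<tau>\<in>rcliques r. real (card (link \<tau>)))\<^sup>2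
      \<le> (\<Sum>\<tau>\<in>rcliques r. (real (card (link \<tau>)))\<^sup>2) * card (rcliques r)"
    by (rule sum_squared_le_sum_of_squares)
  then have "real ((\<Sum>\<tau>\<in>rcliques r. card (link \<tau>))\<^sup>2)
      \<le> real (card (rcliques r) * (\<Sum>\<tau>\<in>rcliques r. (card (link \<tau>))\<^sup>2))"
    by (simp add: mult.commute)
  then show ?thesis by (simp only: of_nat_le_iff sum_card_link)
qed

lemma rcliques_0: "rcliques 0 = {{}}"
  by (auto simp: rcliques_def dest: finite_clique)

lemma card_rcliques_1: "card (rcliques 1) = card V"
  using sum_card_link[of 0] by (simp add: rcliques_0)

lemma rcliques_2: "rcliques 2 = E"
  using fin_simple_graph
  by (auto simp: rcliques_def cliques_def clique_def card_2_iff fin_simple_graph_def nsets_def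
      insert_commute)

text \<open>The Moon--Moser recursion, with the edge density of the Turan graph as starting value.\<close>

lemma rcliques_ratio:
  assumes dense: "(real s - 1) * real (card V) ^ 2 \<le> 2 * real s * real (card E)" and "r < s"
  shows "(real s - real r) * real (card V) * real (card (rcliques r))
           \<le> real s * (real r + 1) * real (card (rcliques (Suc r)))"
    and "(real s - real r) * (real r + 1) * real (card V) * real (card (rcliques (Suc r)))
           \<le> real s * (\<Sum>\<tau>\<in>rcliques r. (real (card (link \<tau>)))\<^sup>2)"
proof -
  let ?n = "real (card V)" and ?k = "\<lambda>r. real (card (rcliques r))"
  let ?S = "\<lambda>r. \<Sum>\<tau>\<in>rcliques r. (real (card (link \<tau>)))\<^sup>2"
  \<comment> \<open>Cauchy-Schwarz turns the first inequality at \<open>r\<close> into the second.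
    The second at \<open>r - 1\<close>, inserted into the Moon-Moser inequality, gives the first at
    \<open>r\<close>.\<close>
  have snd: "(real s - real r) * (real r + 1) * ?n * ?k (Suc r) \<le> real s * ?S r"
    if ratio: "(real s - real r) * ?n * ?k r \<le> real s * (real r + 1) * ?k (Suc r)" and "r < s" for r
  proof (cases "?k (Suc r) = 0")
    case True
    then show ?thesis by (simp add: sum_nonneg)
  next
    case False
    then have pos: "?k (Suc r) > 0" by (simp add: card_gt_0_iff)
    have "real ((Suc r * card (rcliques (Suc r)))\<^sup>2)
        \<le> real (card (rcliques r) * (\<Sum>\<tau>\<in>rcliques r. (card (link \<tau>))\<^sup>2))"
      using card_rcliques_sq_le[of r] by (simp only: of_nat_le_iff)
    then have cs: "((real r + 1) * ?k (Suc r))\<^sup>2 \<le> ?k r * ?S r"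
      by (simp add: add.commute distrib_right)
    have "((real s - real r) * ?n) * ((real r + 1) * ?k (Suc r))\<^sup>2
        \<le> ((real s - real r) * ?n) * (?k r * ?S r)"
      using cs \<open>r < s\<close> by (intro mult_left_mono) auto
    also have "\<dots> = ((real s - real r) * ?n * ?k r) * ?S r" by (simp add: algebra_simps)
    also have "\<dots> \<le> (real s * (real r + 1) * ?k (Suc r)) * ?S r"
      using ratio by (intro mult_right_mono) (auto intro: sum_nonneg)
    finally have "((real r + 1) * ?k (Suc r)) * ((real s - real r) * (real r + 1) * ?n * ?k (Suc r))
        \<le> ((real r + 1) * ?k (Suc r)) * (real s * ?S r)"
      by (simp add: power2_eq_square algebra_simps)
    then show ?thesis
      using pos by (subst (asm) mult_le_cancel_left_pos) auto
  qed
  have fst: "(real s - real r) * ?n * ?k r \<le> real s * (real r + 1) * ?k (Suc r)"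
    if "r < s" for r
    using that
  proof (induction r rule: less_induct)
    case (less r)
    \<comment> \<open>The recursion ends with a division by \<open>q\<close>, so it needs
      \<open>q \<ge> 1\<close>. For \<open>r = 0\<close> there is equality, and for
      \<open>r = 1\<close> the claim is the density hypothesis itself.\<close>
    consider "r = 0" | "r = 1" | q where "r = Suc q" "q \<ge> 1"
      by (cases r) (auto, metis One_nat_def Suc_leI neq0_conv)
    then show ?case
    proof cases
      case 1
      then show ?thesis by (simp add: rcliques_0 card_rcliques_1[simplified])
    next
      case 2
      then show ?thesis
        using dense card_rcliques_1 rcliques_2 by (simp add: power2_eq_square numeral_2_eq_2 algebra_simps)
    next
      case 3
      have q: "q < s" "q < r" using 3 less.prems by auto
      have "(real s - real q) * (real q + 1) * ?n * ?k r \<le> real s * ?S q"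
        using snd[OF less.IH] q 3 by simp
      moreover have "real ((\<Sum>\<tau>\<in>rcliques q. (card (link \<tau>))\<^sup>2)) \<le>
          real (card V * card (rcliques (Suc q)) + q * (q + 2) * card (rcliques (q + 2)))"
        using sum_card_link_sq_le[of q] by (simp only: of_nat_le_iff)
      then have "real s * ?S q \<le> real s * (?n * ?k r + real q * (real q + 2) * ?k (Suc r))"
        using 3 by (intro mult_left_mono) (auto simp: algebra_simps)
      ultimately have "real q * ((real s - real r) * ?n * ?k r)
          \<le> real q * (real s * (real r + 1) * ?k (Suc r))"
        using 3 by (simp add: algebra_simps)
      then show ?thesis using 3 by simp
    qed
  qed
  show "(real s - real r) * ?n * ?k r \<le> real s * (real r + 1) * ?k (Suc r)"
    by (rule fst[OF \<open>r < s\<close>])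
  then show "(real s - real r) * (real r + 1) * ?n * ?k (Suc r) \<le> real s * ?S r"
    by (rule snd[OF _ \<open>r < s\<close>])
qed

text \<open>Iterates the ratio bound. For \<open>r < s\<close> the factor \<open>s - r\<close> is at
  least 1 and \<open>s * (r + 1)\<close> at most \<open>s * s\<close>, so each step costs a factor
  of at most \<open>s ^ 2\<close>.\<close>

lemma card_rcliques_ge:
  assumes dense: "(real s - 1) * real (card V) ^ 2 \<le> 2 * real s * real (card E)" and "r \<le> s"
  shows "real (card V) ^ r \<le> real s ^ (2 * r) * real (card (rcliques r))"
  using assms(2)
proof (induction r)
  case 0
  then show ?case by (simp add: rcliques_0)
next
  case (Suc r)
  let ?n = "real (card V)" and ?k = "\<lambda>r. real (card (rcliques r))"
  have "?n * ?k r \<le> (real s - real r) * ?n * ?k r"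
    using Suc.prems by (simp add: mult.assoc mult_left_le_imp_le) (metis Suc_leD Suc_le_mono
        mult_nonneg_nonneg mult_right_mono mult_1 of_nat_0_le_iff of_nat_diff of_nat_le_iff
        Suc_diff_le le_add1 diff_Suc_Suc zero_less_diff One_nat_def of_nat_1 Suc_leI Suc_le_eq)
  also have "\<dots> \<le> real s * (real r + 1) * ?k (Suc r)"
    using rcliques_ratio(1)[OF dense] Suc.prems by simp
  also have "\<dots> \<le> real s * real s * ?k (Suc r)"
    using Suc.prems by (intro mult_right_mono mult_left_mono) auto
  finally have step: "?n * ?k r \<le> real s ^ 2 * ?k (Suc r)" by (simp add: power2_eq_square)
  have "?n ^ Suc r \<le> ?n * (real s ^ (2 * r) * ?k r)"
    using Suc by (simp add: mult_left_mono)
  also have "\<dots> = real s ^ (2 * r) * (?n * ?k r)" by simp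
  also have "\<dots> \<le> real s ^ (2 * r) * (real s ^ 2 * ?k (Suc r))"
    using step by (intro mult_left_mono) auto
  finally show ?case by (simp add: power2_eq_square mult.assoc mult.left_commute)
qed


section \<open>Colourings, monochromatic edges and missing edges\<close>

definition inside :: "('a \<Rightarrow> 'b) \<Rightarrow> 'a \<Rightarrow> nat" where
  "inside c v = card {u \<in> V. {u, v} \<in> E \<and> c u = c v}"

text \<open>Like \<open>inside\<close> this is a degree, so the sum over \<open>V\<close> counts
  each unordered pair twice.\<close>

definition missing :: "('a \<Rightarrow> 'b) \<Rightarrow> 'a \<Rightarrow> nat" where
  "missing c v = card {u \<in> V. {u, v} \<notin> E \<and> c u \<noteq> c v}"

definition part :: "('a \<Rightarrow> 'b) \<Rightarrow> 'b \<Rightarrow> 'a set" where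
  "part c i = {v \<in> V. c v = i}"

lemma finite_part [simp, intro]: "finite (part c i)"
  by (simp add: part_def)

text \<open>The colours are the vertices of \<open>\<sigma>\<close>. A vertex gets the one vertex of
  \<open>\<sigma>\<close> that it misses; the choice is arbitrary if it misses none or at least
  two.\<close>

definition clique_colouring :: "'a set \<Rightarrow> 'a \<Rightarrow> 'a" where
  "clique_colouring \<sigma> v =
     (if v \<in> unassigned \<sigma> then SOME u. u \<in> \<sigma> else SOME u. u \<in> \<sigma> \<and> v \<in> link (\<sigma> - {u}))"

lemma clique_colouring_link:
  assumes "v \<in> V" "v \<notin> unassigned \<sigma>"
  shows "clique_colouring \<sigma> v \<in> \<sigma> \<and> v \<in> link (\<sigma> - {clique_colouring \<sigma> v})"
proof -
  have "\<exists>u. u \<in> \<sigma> \<and> v \<in> link (\<sigma> - {u})" using assms by (auto simp: unassigned_def)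
  from someI_ex[OF this] show ?thesis using assms by (simp add: clique_colouring_def)
qed

lemma clique_colouring_mem:
  assumes "v \<in> V" "\<sigma> \<noteq> {}"
  shows "clique_colouring \<sigma> v \<in> \<sigma>"
  using assms clique_colouring_link[of v \<sigma>]
  by (cases "v \<in> unassigned \<sigma>") (auto simp: clique_colouring_def some_in_eq)

text \<open>In a monochromatic edge either some end is unassigned, or both ends lie in
  \<open>link (\<sigma> - {u})\<close> for their common colour \<open>u\<close>. In the second case
  they extend \<open>\<sigma> - {u}\<close> to a clique.\<close>

lemma sum_inside_clique_colouring:
  assumes "\<sigma> \<in> cliques V E"
  shows "(\<Sum>v\<in>V. inside (clique_colouring \<sigma>) v)
    \<le> 2 * card V * card (unassigned \<sigma>)
      + (\<Sum>u\<in>\<sigma>. \<Sum>x\<in>link (\<sigma> - {u}). card (link (insert x (\<sigma> - {u}))))"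
proof -
  let ?c = "clique_colouring \<sigma>" and ?R = "unassigned \<sigma>"
  let ?P = "\<lambda>u. SIGMA x:link (\<sigma> - {u}). link (insert x (\<sigma> - {u}))"
  have fs: "finite \<sigma>" using assms by (rule finite_clique)
  have R: "?R \<subseteq> V" by (auto simp: unassigned_def)
  then have fR: "finite ?R" by (rule finite_subset) simp
  have "(\<Sum>v\<in>V. inside ?c v) = card (SIGMA v:V. {u \<in> V. {u, v} \<in> E \<and> ?c u = ?c v})"
    by (simp add: inside_def)
  also have "\<dots> \<le> card ((?R \<times> V \<union> V \<times> ?R) \<union> (\<Union>u\<in>\<sigma>. ?P u))"
  proof (rule card_mono)
    show "finite ((?R \<times> V \<union> V \<times> ?R) \<union> (\<Union>u\<in>\<sigma>. ?P u))" using fs fR by auto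
    show "(SIGMA v:V. {u \<in> V. {u, v} \<in> E \<and> ?c u = ?c v}) \<subseteq> (?R \<times> V \<union> V \<times> ?R) \<union> (\<Union>u\<in>\<sigma>. ?P u)"
    proof (intro subsetI)
      fix p
      assume "p \<in> (SIGMA v:V. {u \<in> V. {u, v} \<in> E \<and> ?c u = ?c v})"
      then obtain v u where p: "p = (v, u)" "v \<in> V" "u \<in> V" "{u, v} \<in> E" "?c u = ?c v"
        by auto
      show "p \<in> (?R \<times> V \<union> V \<times> ?R) \<union> (\<Union>u\<in>\<sigma>. ?P u)"
      proof (cases "u \<in> ?R \<or> v \<in> ?R")
        case True
        then show ?thesis using p by auto
      next
        case False
        then have "?c v \<in> \<sigma>" "v \<in> link (\<sigma> - {?c v})" "u \<in> link (\<sigma> - {?c v})"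
          using p clique_colouring_link[of v \<sigma>] clique_colouring_link[of u \<sigma>] by auto
        then have "p \<in> ?P (?c v)" using p by (auto simp: link_insert insert_commute)
        then show ?thesis using \<open>?c v \<in> \<sigma>\<close> by blast
      qed
    qed
  qed
  also have "\<dots> \<le> (card (?R \<times> V) + card (V \<times> ?R)) + card (\<Union>u\<in>\<sigma>. ?P u)"
    by (meson add_le_mono1 card_Un_le order_trans)
  also have "card (\<Union>u\<in>\<sigma>. ?P u) \<le> (\<Sum>u\<in>\<sigma>. card (?P u))"
    by (rule card_UN_le[OF fs])
  also have "\<dots> = (\<Sum>u\<in>\<sigma>. \<Sum>x\<in>link (\<sigma> - {u}). card (link (insert x (\<sigma> - {u}))))"
    by simp
  finally show ?thesis by (simp add: card_cartesian_product algebra_simps)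
qed

text \<open>Both sides count the \<open>(r + 2)\<close>-cliques with an ordered pair of distinct
  marked vertices, the unmarked ones forming \<open>\<tau>\<close>.\<close>

lemma sum_link_edges:
  "(\<Sum>\<tau>\<in>rcliques r. \<Sum>x\<in>link \<tau>. card (link (insert x \<tau>)))
     = Suc r * (r + 2) * card (rcliques (r + 2))"
proof -
  have "(\<Sum>\<tau>\<in>rcliques r. \<Sum>x\<in>link \<tau>. card (link (insert x \<tau>)))
      = (\<Sum>\<sigma>\<in>rcliques (Suc r). \<Sum>u\<in>\<sigma>. card (link (insert u (\<sigma> - {u}))))"
    by (rule sum_rcliques_link)
  also have "\<dots> = (\<Sum>\<sigma>\<in>rcliques (Suc r). Suc r * card (link \<sigma>))"
    by (intro sum.cong refl) (auto simp: insert_absorb rcliques_def)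
  also have "\<dots> = Suc r * (Suc (Suc r) * card (rcliques (Suc (Suc r))))"
    by (simp only: sum_distrib_left[symmetric] sum_card_link)
  finally show ?thesis by (simp add: algebra_simps)
qed

text \<open>The factor 3 collects 2 from the pairs with an unassigned end and 1 from the pairs that
  extend \<open>\<sigma> - {u}\<close>.\<close>

lemma sum_sum_inside:
  assumes dense: "(real (Suc r) - 1) * real (card V) ^ 2 \<le> 2 * real (Suc r) * real (card E)"
  shows "(\<Sum>\<sigma>\<in>rcliques (Suc r). \<Sum>v\<in>V. inside (clique_colouring \<sigma>) v)
    \<le> 3 * Suc r * (r + 2) * card V * card (rcliques (r + 2))"
proof -
  let ?R = "\<Sum>\<sigma>\<in>rcliques (Suc r). card (unassigned \<sigma>)"
  have "(real (Suc r) - real r) * (real r + 1) * real (card V) * real (card (rcliques (Suc r)))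
      \<le> real (Suc r) * (\<Sum>\<tau>\<in>rcliques r. (real (card (link \<tau>)))\<^sup>2)"
    by (rule rcliques_ratio(2)[OF dense lessI])
  then have "real (Suc r) * real (card V * card (rcliques (Suc r)))
      \<le> real (Suc r) * real (\<Sum>\<tau>\<in>rcliques r. (card (link \<tau>))\<^sup>2)"
    by (simp add: algebra_simps)
  then have "card V * card (rcliques (Suc r)) \<le> (\<Sum>\<tau>\<in>rcliques r. (card (link \<tau>))\<^sup>2)"
    by (simp only: mult_le_cancel_left_pos of_nat_0_less_iff zero_less_Suc of_nat_le_iff)
  \<comment> \<open>At this density the squares of the link sizes alone outweigh the term
    \<open>card V * card (rcliques (Suc r))\<close>, so only the count of
    \<open>(r + 2)\<close>-cliques is left to bound the unassigned vertices.\<close>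
  then have R: "?R \<le> r * (r + 2) * card (rcliques (r + 2))"
    using sum_card_link_sq_le[of r] by linarith
  have "(\<Sum>\<sigma>\<in>rcliques (Suc r). \<Sum>v\<in>V. inside (clique_colouring \<sigma>) v)
      \<le> (\<Sum>\<sigma>\<in>rcliques (Suc r). 2 * card V * card (unassigned \<sigma>)
          + (\<Sum>u\<in>\<sigma>. \<Sum>x\<in>link (\<sigma> - {u}). card (link (insert x (\<sigma> - {u})))))"
    by (intro sum_mono sum_inside_clique_colouring) (simp add: rcliques_def)
  also have "\<dots> = 2 * card V * ?R
      + (\<Sum>\<tau>\<in>rcliques r. \<Sum>v\<in>link \<tau>. \<Sum>x\<in>link \<tau>. card (link (insert x \<tau>)))"
    using sum_rcliques_link[of "\<lambda>\<tau> _. \<Sum>x\<in>link \<tau>. card (link (insert x \<tau>))" r]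
    by (simp only: sum.distrib sum_distrib_left)
  also have "(\<Sum>\<tau>\<in>rcliques r. \<Sum>v\<in>link \<tau>. \<Sum>x\<in>link \<tau>. card (link (insert x \<tau>)))
      \<le> (\<Sum>\<tau>\<in>rcliques r. card V * (\<Sum>x\<in>link \<tau>. card (link (insert x \<tau>))))"
    by (intro sum_mono) (simp add: card_mono link_subset mult_right_mono)
  also have "\<dots> = card V * (Suc r * (r + 2) * card (rcliques (r + 2)))"
    by (simp only: sum_distrib_left[symmetric] sum_link_edges)
  also have "2 * card V * ?R \<le> 2 * card V * (r * (r + 2) * card (rcliques (r + 2)))"
    using R by (rule mult_le_mono2)
  finally show ?thesis
    by (simp add: algebra_simps)
qed

text \<open>Averaging over the \<open>s\<close>-cliques: there are at least
  \<open>card V ^ s / s ^ (2 * s)\<close> of them, while the total cost of their colourings is of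
  order \<open>card V ^ (s + 1)\<close>. The cheapest clique therefore has linear cost.\<close>

lemma near_turan_colouring:
  fixes C :: real
  assumes "s \<ge> 1" "V \<noteq> {}"
    and dense: "(real s - 1) * real (card V) ^ 2 \<le> 2 * real s * real (card E)"
    and few: "real (card (rcliques (s + 1))) \<le> C * real (card V) ^ s"
  obtains I :: "'a set" and c :: "'a \<Rightarrow> 'a"
  where "finite I" "card I = s" "\<forall>v\<in>V. c v \<in> I"
    "real (\<Sum>v\<in>V. inside c v) \<le> 3 * real s * (real s + 1) * real s ^ (2 * s) * C * real (card V)"
proof -
  obtain r where s: "s = Suc r" using \<open>s \<ge> 1\<close> by (cases s) auto
  let ?cost = "\<lambda>\<sigma>. \<Sum>v\<in>V. inside (clique_colouring \<sigma>) v"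
  let ?n = "real (card V)" and ?k = "\<lambda>r. real (card (rcliques r))"
  have npos: "?n > 0" using \<open>V \<noteq> {}\<close> by (simp add: card_gt_0_iff)
  have ks: "?n ^ s \<le> real s ^ (2 * s) * ?k s"
    using card_rcliques_ge[OF dense] by simp
  moreover have "?n ^ s > 0" using npos by simp
  ultimately have "rcliques s \<noteq> {}" by (cases "rcliques s = {}") auto
  then have kpos: "?k s > 0" by (simp add: card_gt_0_iff)
  obtain \<sigma> where \<sigma>: "\<sigma> \<in> rcliques s" "\<And>\<tau>. \<tau> \<in> rcliques s \<Longrightarrow> ?cost \<sigma> \<le> ?cost \<tau>"
    using \<open>rcliques s \<noteq> {}\<close> ex_has_least_nat[of "\<lambda>\<sigma>. \<sigma> \<in> rcliques s" _ ?cost] by blast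
  have "card (rcliques s) * ?cost \<sigma> \<le> (\<Sum>\<tau>\<in>rcliques s. ?cost \<tau>)"
    using sum_bounded_below[of "rcliques s" "?cost \<sigma>" ?cost] \<sigma>(2) by simp
  also have "\<dots> \<le> 3 * Suc r * (r + 2) * card V * card (rcliques (r + 2))"
    using sum_sum_inside[of r] dense s by simp
  finally have "real (card (rcliques s) * ?cost \<sigma>)
      \<le> real (3 * Suc r * (r + 2) * card V * card (rcliques (r + 2)))"
    by (simp only: of_nat_le_iff)
  then have "?k s * real (?cost \<sigma>) \<le> (3 * real s * (real s + 1) * ?n) * ?k (s + 1)"
    by (simp add: s algebra_simps)
  also have "\<dots> \<le> (3 * real s * (real s + 1) * ?n) * (C * ?n ^ s)"
    using few by (intro mult_left_mono) auto
  also have "\<dots> \<le> (3 * real s * (real s + 1) * ?n) * (C * (real s ^ (2 * s) * ?k s))"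
  proof -
    have "0 \<le> C * ?n ^ s" using few by (meson of_nat_0_le_iff order_trans)
    then have "C \<ge> 0"
      using zero_less_power[OF npos, of s] by (auto simp: zero_le_mult_iff)
    then show ?thesis using ks by (intro mult_left_mono) auto
  qed
  finally have "?k s * real (?cost \<sigma>)
      \<le> ?k s * (3 * real s * (real s + 1) * real s ^ (2 * s) * C * ?n)"
    by (simp add: algebra_simps)
  then have "real (?cost \<sigma>) \<le> 3 * real s * (real s + 1) * real s ^ (2 * s) * C * ?n"
    using kpos by (simp only: mult_le_cancel_left_pos)
  moreover have "finite \<sigma>" "card \<sigma> = s" using \<sigma>(1) by (auto simp: rcliques_def dest: finite_clique)
  moreover have "\<forall>v\<in>V. clique_colouring \<sigma> v \<in> \<sigma>"
    using \<open>card \<sigma> = s\<close> \<open>s \<ge> 1\<close> by (auto intro: clique_colouring_mem)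
  ultimately show thesis by (rule that[rotated 3])
qed

text \<open>Isolates the dependence on the colour of \<open>v\<close>: the first summand ignores
  \<open>c v\<close>, and each monochromatic edge at \<open>v\<close> is counted from both
  ends.\<close>

lemma sum_inside_split:
  assumes "v \<in> V"
  shows "(\<Sum>x\<in>V. inside c x)
    = (\<Sum>x\<in>V - {v}. card {u \<in> V - {v}. {u, x} \<in> E \<and> c u = c x}) + 2 * inside c v"
proof -
  have *: "inside c x = card {u \<in> V - {v}. {u, x} \<in> E \<and> c u = c x}
      + of_bool ({v, x} \<in> E \<and> c v = c x)" for x
  proof (cases "{v, x} \<in> E \<and> c v = c x")
    case True
    then have "{u \<in> V. {u, x} \<in> E \<and> c u = c x} = insert v {u \<in> V - {v}. {u, x} \<in> E \<and> c u = c x}"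
      using assms by auto
    then show ?thesis using True by (simp add: inside_def)
  next
    case False
    then have "{u \<in> V. {u, x} \<in> E \<and> c u = c x} = {u \<in> V - {v}. {u, x} \<in> E \<and> c u = c x}"
      by auto
    then show ?thesis using False by (auto simp: inside_def)
  qed
  have "(\<Sum>x\<in>V. inside c x) = inside c v + (\<Sum>x\<in>V - {v}. inside c x)"
    by (rule sum.remove) (use assms in auto)
  also have "(\<Sum>x\<in>V - {v}. inside c x)
      = (\<Sum>x\<in>V - {v}. card {u \<in> V - {v}. {u, x} \<in> E \<and> c u = c x})
        + (\<Sum>x\<in>V - {v}. of_bool ({v, x} \<in> E \<and> c v = c x))"
    by (subst sum.distrib[symmetric]) (intro sum.cong refl *)
  also have "(\<Sum>x\<in>V - {v}. of_bool ({v, x} \<in> E \<and> c v = c x))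
      = card ((V - {v}) \<inter> {x. {v, x} \<in> E \<and> c v = c x})"
    by simp
  also have "(V - {v}) \<inter> {x. {v, x} \<in> E \<and> c v = c x} = {u \<in> V. {u, v} \<in> E \<and> c u = c v}"
    by (auto simp: insert_commute)
  finally show ?thesis by (simp add: inside_def)
qed

text \<open>In a colouring with the fewest monochromatic edges, recolouring \<open>v\<close> with
  \<open>i\<close> cannot help, and afterwards its monochromatic degree is its number of neighbours
  in part \<open>i\<close>.\<close>

lemma max_cut_colouring:
  assumes "\<forall>v\<in>V. c0 v \<in> I"
  obtains c where "\<forall>v\<in>V. c v \<in> I" "(\<Sum>v\<in>V. inside c v) \<le> (\<Sum>v\<in>V. inside c0 v)"
    "\<And>v i. v \<in> V \<Longrightarrow> i \<in> I \<Longrightarrow> inside c v \<le> card (link {v} \<inter> part c i)"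
proof -
  obtain c where c: "\<forall>v\<in>V. c v \<in> I"
    "\<And>c'. \<forall>v\<in>V. c' v \<in> I \<Longrightarrow> (\<Sum>v\<in>V. inside c v) \<le> (\<Sum>v\<in>V. inside c' v)"
    using ex_has_least_nat[of "\<lambda>c. \<forall>v\<in>V. c v \<in> I" c0 "\<lambda>c. \<Sum>v\<in>V. inside c v"] assms by blast
  have "inside c v \<le> card (link {v} \<inter> part c i)" if "v \<in> V" "i \<in> I" for v i
  proof -
    let ?c = "c(v := i)"
    have "(\<Sum>x\<in>V. inside c x) \<le> (\<Sum>x\<in>V. inside ?c x)"
      using c that by auto
    moreover have "(\<Sum>x\<in>V - {v}. card {u \<in> V - {v}. {u, x} \<in> E \<and> ?c u = ?c x})
        = (\<Sum>x\<in>V - {v}. card {u \<in> V - {v}. {u, x} \<in> E \<and> c u = c x})"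
      by (intro sum.cong refl arg_cong[where f = card]) auto
    ultimately have "inside c v \<le> inside ?c v"
      unfolding sum_inside_split[OF \<open>v \<in> V\<close>] by simp
    also have "{u \<in> V. {u, v} \<in> E \<and> ?c u = ?c v} = link {v} \<inter> part c i"
      by (auto simp: link_verts_def part_def insert_commute)
    then have "inside ?c v = card (link {v} \<inter> part c i)" by (simp add: inside_def)
    finally show ?thesis .
  qed
  then show thesis using that c assms by blast
qed

lemma handshake: "(\<Sum>v\<in>V. card (link {v})) = 2 * card E"
proof -
  have "rcliques 1 = (\<lambda>v. {v}) ` V"
    by (auto simp: rcliques_def card_1_singleton_iff singleton_clique dest: clique_subset_V)
  then have "(\<Sum>\<tau>\<in>rcliques 1. card (link \<tau>)) = (\<Sum>v\<in>V. card (link {v}))"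
    by (simp add: sum.reindex)
  then show ?thesis using sum_card_link[of 1] rcliques_2 by (simp add: numeral_2_eq_2)
qed

text \<open>For each \<open>v\<close>, the degree, the missing pairs and the own part together count
  every vertex once, except that the neighbours in the own part are counted twice. Summed over
  \<open>V\<close>, part sizes become squares.\<close>

lemma edge_count:
  assumes "finite I" "\<forall>v\<in>V. c v \<in> I"
  shows "2 * card E + (\<Sum>v\<in>V. missing c v) + (\<Sum>i\<in>I. (card (part c i))\<^sup>2)
    = (\<Sum>v\<in>V. inside c v) + (card V)\<^sup>2"
proof -
  have "card (link {v}) + missing c v + card (part c (c v)) = inside c v + card V"
    if "v \<in> V" for v
  proof -
    let ?A = "{u \<in> V. {u, v} \<in> E \<and> c u \<noteq> c v}" and ?I = "{u \<in> V. {u, v} \<in> E \<and> c u = c v}"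
      and ?M = "{u \<in> V. {u, v} \<notin> E \<and> c u \<noteq> c v}"
    have "card (link {v}) = card (?I \<union> ?A)"
      by (rule arg_cong[where f = card]) (auto simp: link_verts_def insert_commute)
    also have "\<dots> = card ?I + card ?A" by (rule card_Un_disjoint) auto
    finally have 1: "card (link {v}) = card ?I + card ?A" .
    have "card V = card (part c (c v) \<union> (?A \<union> ?M))"
      by (rule arg_cong[where f = card]) (auto simp: part_def)
    also have "\<dots> = card (part c (c v)) + card (?A \<union> ?M)"
      by (rule card_Un_disjoint) (auto simp: part_def)
    also have "card (?A \<union> ?M) = card ?A + card ?M" by (rule card_Un_disjoint) auto
    finally show ?thesis using 1 by (simp add: inside_def missing_def)
  qed
  then have "(\<Sum>v\<in>V. card (link {v}) + missing c v + card (part c (c v)))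
      = (\<Sum>v\<in>V. inside c v + card V)"
    by (rule sum.cong[OF refl])
  moreover have "(\<Sum>v\<in>V. card (part c (c v))) = (\<Sum>i\<in>I. (card (part c i))\<^sup>2)"
  proof -
    have "(\<Sum>v\<in>V. card (part c (c v))) = (\<Sum>i\<in>I. \<Sum>v\<in>{x \<in> V. c x = i}. card (part c (c v)))"
      using assms by (intro sum.group[symmetric]) auto
    also have "\<dots> = (\<Sum>i\<in>I. (card (part c i))\<^sup>2)"
      by (intro sum.cong refl) (simp add: part_def power2_eq_square)
    finally show ?thesis .
  qed
  ultimately show ?thesis
    by (simp add: sum.distrib handshake power2_eq_square)
qed

lemma sum_over_parts:
  assumes "finite I" "\<forall>v\<in>V. c v \<in> I"
  shows "(\<Sum>i\<in>I. sum f (part c i)) = sum f V"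
  unfolding part_def using assms by (intro sum.group) auto

lemma sum_card_part:
  assumes "finite I" "\<forall>v\<in>V. c v \<in> I"
  shows "(\<Sum>i\<in>I. card (part c i)) = card V"
  using sum_over_parts[OF assms, of "\<lambda>_. 1::nat"] by simp

lemma card_V_sq_le:
  assumes "finite I" "\<forall>v\<in>V. c v \<in> I"
  shows "(real (card V))\<^sup>2 \<le> card I * (\<Sum>i\<in>I. (real (card (part c i)))\<^sup>2)"
proof -
  have "real (card V) = (\<Sum>i\<in>I. real (card (part c i)))"
    using arg_cong[OF sum_card_part[OF assms], of real] by simp
  then show ?thesis
    using sum_squared_le_sum_of_squares[of "\<lambda>i. real (card (part c i))" I]
    by (simp add: mult.commute)
qed

text \<open>The density and the few monochromatic edges bound the sum of squared deviations of the
  part sizes from \<open>n / s\<close> by \<open>C * n\<close>, so no single part deviates by more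
  than \<open>n / (2 * s)\<close>.\<close>

lemma card_part_ge:
  assumes "finite I" "\<forall>v\<in>V. c v \<in> I" "card I = s" "s \<ge> 1"
    and dense: "(real s - 1) * real (card V) ^ 2 \<le> 2 * real s * real (card E)"
    and few: "real (\<Sum>v\<in>V. inside c v) \<le> C * real (card V)"
    and large: "4 * real s ^ 2 * C \<le> real (card V)"
    and "i \<in> I"
  shows "real (card V) / (2 * real s) \<le> real (card (part c i))"
proof -
  let ?n = "real (card V)" and ?a = "\<lambda>i. real (card (part c i))"
  have "real (2 * card E + (\<Sum>v\<in>V. missing c v) + (\<Sum>i\<in>I. (card (part c i))\<^sup>2))
      = real ((\<Sum>v\<in>V. inside c v) + (card V)\<^sup>2)"
    using edge_count[OF assms(1,2)] by simp
  then have "2 * real (card E) + (\<Sum>i\<in>I. (?a i)\<^sup>2) \<le> C * ?n + ?n\<^sup>2"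
    using few by simp (smt (verit) of_nat_0_le_iff sum_nonneg)
  moreover have "?n\<^sup>2 - ?n\<^sup>2 / real s \<le> 2 * real (card E)"
    using dense \<open>s \<ge> 1\<close> by (simp add: field_simps)
  ultimately have sq: "(\<Sum>i\<in>I. (?a i)\<^sup>2) \<le> C * ?n + ?n\<^sup>2 / real s" by linarith
  have suma: "(\<Sum>i\<in>I. ?a i) = ?n"
    using arg_cong[OF sum_card_part[OF assms(1,2)], of real] by simp
  have "(?a i - ?n / real s)\<^sup>2 \<le> (\<Sum>i\<in>I. (?a i - ?n / real s)\<^sup>2)"
    by (rule member_le_sum) (use assms in auto)
  also have "\<dots> = (\<Sum>i\<in>I. (?a i)\<^sup>2) - 2 * ?n / real s * (\<Sum>i\<in>I. ?a i) + real s * (?n / real s)\<^sup>2"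
    by (simp add: power2_diff sum.distrib sum_subtractf sum_distrib_left sum_divide_distrib
        \<open>card I = s\<close> mult_ac)
  also have "\<dots> = (\<Sum>i\<in>I. (?a i)\<^sup>2) - ?n\<^sup>2 / real s"
    unfolding suma using \<open>s \<ge> 1\<close> by (simp add: field_simps power2_eq_square)
  also have "\<dots> \<le> C * ?n" using sq by linarith
  \<comment> \<open>The threshold \<open>4 * s ^ 2 * C\<close> for the number of vertices is chosen
    for this inequality.\<close>
  also have "\<dots> \<le> (?n / (2 * real s))\<^sup>2"
  proof -
    have "(4 * real s ^ 2 * C) * ?n \<le> ?n * ?n" using large by (intro mult_right_mono) auto
    then show ?thesis using \<open>s \<ge> 1\<close> by (simp add: power2_eq_square field_simps)
  qed
  finally have "\<bar>?a i - ?n / real s\<bar> \<le> \<bar>?n / (2 * real s)\<bar>"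
    by (simp only: abs_le_square_iff)
  then have "?n / real s - ?a i \<le> ?n / (2 * real s)" by (simp add: abs_le_iff)
  moreover have "?n / real s = ?n / (2 * real s) + ?n / (2 * real s)" by simp
  ultimately show ?thesis by linarith
qed

section \<open>Common neighbourhoods and adjacent pairs inside a part\<close>

lemma link_Un: "link (\<sigma> \<union> \<tau>) = link \<sigma> \<inter> link \<tau>"
  by (auto simp: link_verts_def)

lemma clique_extends_maximal:
  assumes "\<sigma> \<in> cliques V E"
  obtains F where "maximal_clique V E F" "\<sigma> \<subseteq> F"
  using finite_has_maximal2[OF finite_cliques assms] unfolding maximal_clique_def by metis

text \<open>A vertex of part \<open>j\<close> outside \<open>link Y\<close> is non-adjacent to some
  \<open>y\<close> of another colour, hence counted by \<open>missing c y\<close>.\<close>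

lemma card_part_diff_link_le:
  assumes "finite Y" "\<And>y. y \<in> Y \<Longrightarrow> c y \<noteq> j"
  shows "card (part c j - link Y) \<le> (\<Sum>y\<in>Y. missing c y)"
proof -
  have "part c j - link Y \<subseteq> (\<Union>y\<in>Y. {u \<in> V. {u, y} \<notin> E \<and> c u \<noteq> c y})"
  proof
    fix u assume u: "u \<in> part c j - link Y"
    then obtain y where "y \<in> Y" "{y, u} \<notin> E" by (auto simp: part_def link_verts_def)
    then show "u \<in> (\<Union>y\<in>Y. {u \<in> V. {u, y} \<notin> E \<and> c u \<noteq> c y})"
      using u assms(2)[of y] by (auto simp: part_def insert_commute)
  qed
  then have "card (part c j - link Y) \<le> card (\<Union>y\<in>Y. {u \<in> V. {u, y} \<notin> E \<and> c u \<noteq> c y})"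
    by (rule card_mono[rotated]) (use assms(1) in auto)
  also have "\<dots> \<le> (\<Sum>y\<in>Y. missing c y)"
    unfolding missing_def by (rule card_UN_le[OF assms(1)])
  finally show ?thesis .
qed

text \<open>With degrees at most 2, each vertex occurs in at most four ordered adjacent pairs, twice
  as first and twice as second entry.\<close>

lemma sum_adjacent_pairs_le:
  fixes f :: "'a \<Rightarrow> real"
  assumes "finite G" "\<And>y. y \<in> G \<Longrightarrow> card {z \<in> G. {y, z} \<in> E} \<le> 2" "\<And>y. y \<in> G \<Longrightarrow> f y \<ge> 0"
  shows "(\<Sum>y\<in>G. \<Sum>z | z \<in> G \<and> {y, z} \<in> E. f y + f z) \<le> 4 * sum f G"
proof -
  have 1: "(\<Sum>y\<in>G. \<Sum>z | z \<in> G \<and> {y, z} \<in> E. f y) \<le> (\<Sum>y\<in>G. 2 * f y)"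
  proof (rule sum_mono)
    fix y assume "y \<in> G"
    then have "real (card {z \<in> G. {y, z} \<in> E}) \<le> 2" using assms(2) by force
    then have "real (card {z \<in> G. {y, z} \<in> E}) * f y \<le> 2 * f y"
      using assms(3) \<open>y \<in> G\<close> by (intro mult_right_mono) auto
    then show "(\<Sum>z | z \<in> G \<and> {y, z} \<in> E. f y) \<le> 2 * f y" by simp
  qed
  have "(\<Sum>y\<in>G. \<Sum>z | z \<in> G \<and> {y, z} \<in> E. f z) = (\<Sum>z\<in>G. \<Sum>y | y \<in> G \<and> {y, z} \<in> E. f z)"
    by (rule sum.swap_restrict) (use assms in auto)
  also have "\<dots> = (\<Sum>y\<in>G. \<Sum>z | z \<in> G \<and> {y, z} \<in> E. f y)"
    by (simp add: insert_commute)
  finally have "(\<Sum>y\<in>G. \<Sum>z | z \<in> G \<and> {y, z} \<in> E. f y + f z)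
      = 2 * (\<Sum>y\<in>G. \<Sum>z | z \<in> G \<and> {y, z} \<in> E. f y)"
    by (simp only: sum.distrib mult_2)
  also have "\<dots> \<le> 2 * (\<Sum>y\<in>G. 2 * f y)" using 1 by simp
  also have "\<dots> = 4 * sum f G" by (simp add: sum_distrib_left)
  finally show ?thesis .
qed

end

section \<open>Leveled graphs\<close>

locale leveled_graph = finite_graph +
  fixes s :: nat
  assumes leveled: "leveled (2 * s - 1) V E" and s_pos: "s \<ge> 1"
begin

lemma card_maximal_clique: "maximal_clique V E F \<Longrightarrow> card F = 2 * s"
  using leveled s_pos by (simp add: leveled_def)

lemma card_clique_le:
  assumes "\<sigma> \<in> cliques V E" shows "card \<sigma> \<le> 2 * s"
proof -
  obtain F where F: "maximal_clique V E F" "\<sigma> \<subseteq> F"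
    using clique_extends_maximal[OF assms] .
  then have "finite F" by (auto simp: maximal_clique_def dest: finite_clique)
  then show ?thesis using F card_mono card_maximal_clique by metis
qed

lemma card_link_ridge: "\<sigma> \<in> cliques V E \<Longrightarrow> Suc (card \<sigma>) = 2 * s \<Longrightarrow> card (link \<sigma>) = 2"
proof -
  assume "\<sigma> \<in> cliques V E" "Suc (card \<sigma>) = 2 * s"
  moreover then have "card \<sigma> = 2 * s - 1" by linarith
  ultimately show ?thesis using leveled by (simp add: leveled_def)
qed

text \<open>Adding \<open>v\<close> to \<open>T\<close> gives a ridge, and its two completions are
  the neighbours of \<open>v\<close> in \<open>link T\<close>. So \<open>link T\<close> induces a
  2-regular graph.\<close>

lemma card_link_pair:
  assumes "T \<in> cliques V E" "card T + 2 = 2 * s" "v \<in> link T"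
  shows "card {u \<in> link T. {u, v} \<in> E} = 2"
proof -
  have "insert v T \<in> cliques V E" using assms by (simp add: insert_clique)
  moreover have "card (insert v T) = Suc (card T)"
    using assms finite_clique link_not_mem by auto
  ultimately have "card (link (insert v T)) = 2"
    using card_link_ridge assms by auto
  then show ?thesis by (simp add: link_insert insert_commute)
qed

text \<open>Each vertex of \<open>X\<close> without a neighbour in \<open>I\<close> completes some ridge that avoids \<open>I\<close>, a
  ridge is completed by only two vertices, and there are few ridges avoiding \<open>I\<close>.\<close>

lemma adjacent_in_link:
  assumes Y: "Y \<in> cliques V E" and "X \<subseteq> I" "I \<subseteq> link Y"
    and B: "card (link Y - I) \<le> B" and X: "card X > 2 * 2 ^ B"
  obtains y z where "y \<in> X" "z \<in> I" "{y, z} \<in> E"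
proof (rule ccontr)
  assume "\<not> thesis"
  then have no: "\<And>y z. y \<in> X \<Longrightarrow> z \<in> I \<Longrightarrow> {y, z} \<notin> E" using that by blast
  have finX: "finite X" using assms(2,3) finite_link by (meson finite_subset)
  have "\<exists>F. maximal_clique V E F \<and> insert y Y \<subseteq> F" if "y \<in> X" for y
  proof -
    have "insert y Y \<in> cliques V E" using that assms by (intro insert_clique) auto
    then show ?thesis using clique_extends_maximal by metis
  qed
  then obtain F where F: "\<And>y. y \<in> X \<Longrightarrow> maximal_clique V E (F y)"
    "\<And>y. y \<in> X \<Longrightarrow> insert y Y \<subseteq> F y" by metis
  \<comment> \<open>\<open>F y\<close> is a facet through \<open>y\<close> and \<open>Y\<close>. Its
    remaining vertices are adjacent to \<open>y\<close>, so by assumption none lies in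
    \<open>I\<close>.\<close>
  define g where "g y = F y - {y} - Y" for y
  have Fc: "F y \<in> cliques V E" if "y \<in> X" for y using F that by (simp add: maximal_clique_def)
  have yY: "y \<notin> Y" if "y \<in> X" for y using that assms(2,3) link_not_mem by blast
  have g: "g y \<subseteq> link Y - I" if "y \<in> X" for y
  proof
    fix w assume w: "w \<in> g y"
    then have wF: "w \<in> F y" "w \<noteq> y" "w \<notin> Y" by (auto simp: g_def)
    have "w \<in> link Y"
      using wF F(2)[OF that] clique_edge[OF Fc[OF that], of _ w] clique_subset_V[OF Fc[OF that]]
      by (auto simp: link_verts_def)
    moreover have "{y, w} \<in> E" using wF F(2)[OF that] clique_edge[OF Fc[OF that], of y w] by auto
    ultimately show "w \<in> link Y - I" using no that by auto
  qed
  \<comment> \<open>Vertices with the same value of \<open>g\<close> complete the same ridge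
    \<open>F x - {x}\<close>, which has only two completions.\<close>
  have fibre: "card {y \<in> X. g y = g x} \<le> 2" if "x \<in> X" for x
  proof -
    have "card (link (F x - {x})) = 2"
    proof (rule card_link_ridge)
      show "F x - {x} \<in> cliques V E" by (rule clique_mono[OF Fc[OF that]]) auto
      have "x \<in> F x" "finite (F x)" using F that Fc finite_clique by auto
      then have "Suc (card (F x - {x})) = card (F x)" by (intro card_Suc_Diff1)
      then show "Suc (card (F x - {x})) = 2 * s" using F that by (simp add: card_maximal_clique)
    qed
    moreover have "{y \<in> X. g y = g x} \<subseteq> link (F x - {x})"
    proof
      fix y assume "y \<in> {y \<in> X. g y = g x}"
      then have y: "y \<in> X" "g y = g x" by auto
      have "F y - {y} = F x - {x}"
        using y that F(2)[of x] F(2)[of y] yY[of x] yY[of y] unfolding g_def by blast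
      moreover have "y \<in> link (F y - {y})"
        using F(2) y Fc by (intro mem_link_remove) auto
      ultimately show "y \<in> link (F x - {x})" by simp
    qed
    ultimately show ?thesis using card_mono[OF finite_link] by metis
  qed
  have "X = (\<Union>b\<in>g ` X. {y \<in> X. g y = b})" by auto
  then have "card X \<le> (\<Sum>b\<in>g ` X. card {y \<in> X. g y = b})"
    using card_UN_le[of "g ` X" "\<lambda>b. {y \<in> X. g y = b}"] finX by simp
  also have "\<dots> \<le> (\<Sum>b\<in>g ` X. 2)" using fibre by (intro sum_mono) auto
  also have "\<dots> \<le> 2 * card (Pow (link Y - I))"
    using g finX by (auto intro!: card_mono)
  also have "\<dots> \<le> 2 * 2 ^ B" using B by (simp add: card_Pow)
  finally show False using X by simp
qed

end

section \<open>Near-Turan colourings of leveled graphs\<close>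

text \<open>Two thresholds on defects are in force: up to \<open>\<epsilon> * card V\<close>,
  exceeded by at most \<open>b\<close> vertices, and up to the constant \<open>K\<close>, exceeded
  by at most a \<open>\<delta> / 4\<close> fraction. \<open>large\<close> makes
  \<open>\<delta> / 2 * card V\<close> available vertices enough for \<open>adjacent_in_link\<close>
  with \<open>B = s * K + b\<close>. The value of \<open>\<delta>\<close> makes the error bounds of
  the \<open>s\<close> parts add up to \<open>total_missing\<close> in the end.\<close>

locale coloured_leveled_graph = leveled_graph V E s
  for V :: "'a set" and E s +
  fixes I :: "'b set" and c :: "'a \<Rightarrow> 'b" and \<delta> \<epsilon> :: real and K b :: nat
  assumes finite_I: "finite I" and card_I: "card I = s" and colour: "v \<in> V \<Longrightarrow> c v \<in> I"
    and max_cut: "v \<in> V \<Longrightarrow> i \<in> I \<Longrightarrow> inside c v \<le> card (link {v} \<inter> part c i)"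
    and part_ge: "i \<in> I \<Longrightarrow> real (card V) / (2 * real s) \<le> real (card (part c i))"
    and few_bad: "card {v \<in> V. real (inside c v + missing c v) > \<epsilon> * real (card V)} \<le> b"
    and few_atypical: "real (card {v \<in> V. inside c v + missing c v > K}) \<le> \<delta> / 4 * real (card V)"
    and \<delta>: "64 * real s ^ 3 * \<delta> = 1" and \<epsilon>: "8 * real s * \<epsilon> \<le> \<delta>"
    and K_le: "real K \<le> \<epsilon> * real (card V)"
    and large: "2 * 2 ^ (s * K + b) < \<delta> / 2 * real (card V)"
begin

definition good :: "'a set" where
  "good = {v \<in> V. real (inside c v + missing c v) \<le> \<epsilon> * real (card V)}"

definition typical :: "'a set" where
  "typical = {v \<in> V. inside c v + missing c v \<le> K}"

lemma typical_subset_good: "typical \<subseteq> good"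
  using K_le by (force simp: typical_def good_def)

lemma good_subset_V: "good \<subseteq> V"
  by (auto simp: good_def)

lemma finite_good [simp]: "finite good" and finite_typical [simp]: "finite typical"
  by (auto simp: good_def typical_def)

lemma V_nonempty: "card V > 0"
proof (rule ccontr)
  assume "\<not> card V > 0"
  then have "\<delta> / 2 * real (card V) = 0" by simp
  moreover have "(0::real) < 2 * 2 ^ (s * K + b)" by simp
  ultimately show False using large by linarith
qed

lemma \<delta>_pos: "\<delta> > 0"
proof (rule ccontr)
  assume "\<not> \<delta> > 0"
  then have "64 * real s ^ 3 * \<delta> \<le> 0" by (intro mult_nonneg_nonpos) auto
  then show False using \<delta> by simp
qed

lemma \<delta>_le: "64 * real s * \<delta> \<le> 1"
proof -
  have "real s * 1 \<le> real s * (real s * real s)"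
    using s_pos by (intro mult_left_mono) (auto intro: mult_ge1_I)
  then have "64 * real s \<le> 64 * real s ^ 3" using s_pos by (simp add: power3_eq_cube mult.assoc)
  then have "64 * real s * \<delta> \<le> 64 * real s ^ 3 * \<delta>" using \<delta>_pos by (intro mult_right_mono) auto
  then show ?thesis using \<delta> by simp
qed

lemma card_eq_sum_colours:
  assumes "Y \<subseteq> V"
  shows "card Y = (\<Sum>i\<in>I. card {y \<in> Y. c y = i})"
proof -
  have "finite Y" using assms finite_V by (rule finite_subset)
  then have "(\<Sum>i\<in>I. sum (\<lambda>_. 1::nat) {y \<in> Y. c y = i}) = sum (\<lambda>_. 1) Y"
    using finite_I assms colour by (intro sum.group) auto
  then show ?thesis by simp
qed

text \<open>At most \<open>2 * s\<close> good vertices together miss at most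
  \<open>2 * s * \<epsilon> * card V\<close> vertices of part \<open>j\<close>, which is at most
  \<open>\<delta> / 4 * card V\<close>; the atypical vertices cost as much again.\<close>

lemma typical_available:
  assumes Y: "Y \<subseteq> good" "card Y \<le> 2 * s" "\<And>y. y \<in> Y \<Longrightarrow> c y \<noteq> j" and A: "A \<subseteq> part c j"
  shows "real (card A) - \<delta> / 2 * real (card V) \<le> real (card (A \<inter> typical \<inter> link Y))"
proof -
  let ?n = "real (card V)"
  have finY: "finite Y" using Y(1) finite_good by (rule finite_subset)
  have "real (\<Sum>y\<in>Y. missing c y) \<le> (\<Sum>y\<in>Y. \<epsilon> * ?n)"
    unfolding of_nat_sum using Y(1) by (intro sum_mono) (force simp: good_def)
  also have "\<dots> = real (card Y) * (\<epsilon> * ?n)" by simp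
  also have "\<dots> \<le> (2 * real s) * (\<epsilon> * ?n)"
    using Y(2) K_le by (intro mult_right_mono) (auto intro: order_trans[of 0 "real K"])
  also have "\<dots> = (8 * real s * \<epsilon>) * ?n / 4" by simp
  also have "\<dots> \<le> \<delta> * ?n / 4" using \<epsilon> by (intro divide_right_mono mult_right_mono) auto
  finally have "real (\<Sum>y\<in>Y. missing c y) \<le> \<delta> * ?n / 4" .
  moreover have "card (part c j - link Y) \<le> (\<Sum>y\<in>Y. missing c y)"
    by (rule card_part_diff_link_le[OF finY]) (rule Y(3))
  ultimately have 1: "real (card (part c j - link Y)) \<le> \<delta> * ?n / 4" by linarith
  have finA: "finite A" using A finite_part by (rule finite_subset)
  have "A \<subseteq> (A \<inter> typical \<inter> link Y) \<union> ({v \<in> V. inside c v + missing c v > K} \<union> (part c j - link Y))"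
    using A by (auto simp: typical_def part_def)
  then have "card A \<le> card ((A \<inter> typical \<inter> link Y) \<union> ({v \<in> V. inside c v + missing c v > K} \<union> (part c j - link Y)))"
    by (rule card_mono[rotated]) (use finA in auto)
  also have "\<dots> \<le> card (A \<inter> typical \<inter> link Y)
      + (card {v \<in> V. inside c v + missing c v > K} + card (part c j - link Y))"
    by (meson add_left_mono card_Un_le order_trans)
  finally have "card A \<le> card (A \<inter> typical \<inter> link Y)
      + (card {v \<in> V. inside c v + missing c v > K} + card (part c j - link Y))" .
  then show ?thesis using 1 few_atypical by linarith
qed

text \<open>A vertex of \<open>link Y\<close> with colour \<open>i \<noteq> j\<close> is a
  monochromatic neighbour of the typical vertex of colour \<open>i\<close> in \<open>Y\<close>,
  which has at most \<open>K\<close> of them. What remains lies in part \<open>j\<close> but is not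
  good.\<close>

lemma card_link_outside_part:
  assumes "\<And>i. i \<in> I \<Longrightarrow> i \<noteq> j \<Longrightarrow> \<exists>y\<in>Y. y \<in> typical \<and> c y = i"
  shows "card (link Y - part c j \<inter> good) \<le> s * K + b"
proof -
  have "\<forall>i\<in>I - {j}. \<exists>y. y \<in> Y \<and> y \<in> typical \<and> c y = i" using assms by blast
  from bchoice[OF this] obtain y
    where "\<forall>i\<in>I - {j}. y i \<in> Y \<and> y i \<in> typical \<and> c (y i) = i" by blast
  then have y: "y i \<in> Y \<and> y i \<in> typical \<and> c (y i) = i" if "i \<in> I - {j}" for i
    using that by blast
  let ?U = "\<Union>i\<in>I - {j}. {u \<in> V. {u, y i} \<in> E \<and> c u = c (y i)}"
  let ?B = "{v \<in> V. real (inside c v + missing c v) > \<epsilon> * real (card V)}"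
  have "link Y - part c j \<inter> good \<subseteq> ?U \<union> ?B"
  proof
    fix w assume w: "w \<in> link Y - part c j \<inter> good"
    then have wV: "w \<in> V" using link_subset by auto
    show "w \<in> ?U \<union> ?B"
    proof (cases "c w = j")
      case True
      then have "w \<notin> good" using w wV by (auto simp: part_def)
      then show ?thesis using wV by (auto simp: good_def)
    next
      case False
      then have cw: "c w \<in> I - {j}" using colour wV by auto
      then have "{w, y (c w)} \<in> E" using y[OF cw] w by (auto simp: link_verts_def insert_commute)
      then have "w \<in> {u \<in> V. {u, y (c w)} \<in> E \<and> c u = c (y (c w))}"
        using y[OF cw] wV by simp
      then show ?thesis using cw by blast
    qed
  qed
  then have "card (link Y - part c j \<inter> good) \<le> card (?U \<union> ?B)"
    by (rule card_mono[rotated]) (use finite_I in auto)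
  also have "\<dots> \<le> card ?U + card ?B" by (rule card_Un_le)
  also have "card ?U \<le> (\<Sum>i\<in>I - {j}. inside c (y i))"
    unfolding inside_def by (rule card_UN_le) (use finite_I in auto)
  also have "\<dots> \<le> (\<Sum>i\<in>I - {j}. K)"
  proof (rule sum_mono)
    fix i assume "i \<in> I - {j}"
    then have "y i \<in> typical" using y by blast
    then show "inside c (y i) \<le> K" by (simp add: typical_def)
  qed
  also have "\<dots> \<le> (\<Sum>i\<in>I. K)" using finite_I by (intro sum_mono2) auto
  also have "\<dots> = s * K" by (simp add: card_I)
  finally show ?thesis using few_bad by linarith
qed

section \<open>Cliques with two vertices of every colour\<close>

text \<open>Greedy choice: when a colour is treated, at least \<open>\<delta> / 2 * card V\<close>
  typical candidates in \<open>link Q\<close> are adjacent to all vertices chosen so far.\<close>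

lemma typical_transversal:
  assumes Q: "Q \<in> cliques V E" "\<And>i. i \<in> I \<Longrightarrow> \<delta> * real (card V) \<le> real (card (link Q \<inter> part c i))"
    and "J \<subseteq> I"
  shows "\<exists>Y. Y \<subseteq> typical \<inter> link Q \<and> Q \<union> Y \<in> cliques V E \<and> c ` Y = J"
proof -
  have "finite J" using \<open>J \<subseteq> I\<close> finite_I by (rule finite_subset)
  then show ?thesis using \<open>J \<subseteq> I\<close>
  proof (induction J)
    case empty
    then show ?case using Q by auto
  next
    case (insert j J)
    then obtain Y where Y: "Y \<subseteq> typical \<inter> link Q" "Q \<union> Y \<in> cliques V E" "c ` Y = J" by auto
    have "Y \<in> cliques V E" using Y(2) by (rule clique_mono) auto
    then have "real (card (link Q \<inter> part c j)) - \<delta> / 2 * real (card V)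
        \<le> real (card (link Q \<inter> part c j \<inter> typical \<inter> link Y))"
      using Y typical_subset_good insert.hyps
      by (intro typical_available) (auto intro: card_clique_le)
    moreover have "\<delta> * real (card V) \<le> real (card (link Q \<inter> part c j))"
      using Q(2) insert.prems by simp
    moreover have "\<delta> * real (card V) > 0" using \<delta>_pos V_nonempty by simp
    ultimately have "real (card (link Q \<inter> part c j \<inter> typical \<inter> link Y)) > 0" by linarith
    then obtain x where x: "x \<in> link Q \<inter> part c j \<inter> typical \<inter> link Y"
      by (metis card.empty equals0I of_nat_0 less_irrefl)
    then have "insert x (Q \<union> Y) \<in> cliques V E"
      using Y(2) by (intro insert_clique) (auto simp: link_Un)
    moreover have "c ` insert x Y = insert j J" using x Y(3) by (auto simp: part_def)
    ultimately show ?case using x Y(1) by (intro exI[of _ "insert x Y"]) auto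
  qed
qed

text \<open>Starts from a typical transversal and replaces its vertices colour by colour. The clique
  \<open>Q\<close> is a single vertex in one application and empty in the other.\<close>

lemma paired_clique:
  assumes Q: "Q \<in> cliques V E" "\<And>i. i \<in> I \<Longrightarrow> \<delta> * real (card V) \<le> real (card (link Q \<inter> part c i))"
  obtains Y where "Y \<subseteq> good \<inter> link Q" "Q \<union> Y \<in> cliques V E"
    "\<And>i. i \<in> I \<Longrightarrow> \<exists>y\<in>Y. y \<in> typical \<and> c y = i"
    "\<And>i. i \<in> I \<Longrightarrow> 2 \<le> card {y \<in> Y. c y = i}"
proof -
  have "\<exists>Y. Y \<subseteq> good \<inter> link Q \<and> Q \<union> Y \<in> cliques V E \<and> (\<forall>i\<in>I. \<exists>y\<in>Y. y \<in> typical \<and> c y = i)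
      \<and> (\<forall>i\<in>J. 2 \<le> card {y \<in> Y. c y = i})" if "finite J" "J \<subseteq> I" for J
    using that
  proof (induction J)
    case empty
    obtain Y where "Y \<subseteq> typical \<inter> link Q" "Q \<union> Y \<in> cliques V E" "c ` Y = I"
      using typical_transversal[OF Q, of I] by auto
    then show ?case using typical_subset_good by (intro exI[of _ Y]) blast
  next
    case (insert j J)
    then obtain Y where Y: "Y \<subseteq> good \<inter> link Q" "Q \<union> Y \<in> cliques V E"
      "\<forall>i\<in>I. \<exists>y\<in>Y. y \<in> typical \<and> c y = i" "\<forall>i\<in>J. 2 \<le> card {y \<in> Y. c y = i}" by auto
    \<comment> \<open>Dropping colour \<open>j\<close> leaves a typical vertex in each other colour,
      so \<open>link (Q \<union> Z)\<close> lies in the good vertices of part \<open>j\<close> up to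
      \<open>s * K + b\<close> exceptions.\<close>
    define Z where "Z = {y \<in> Y. c y \<noteq> j}"
    have Z: "Z \<subseteq> good \<inter> link Q" "Q \<union> Z \<in> cliques V E"
      using Y(1) clique_mono[OF Y(2), of "Q \<union> Z"] by (auto simp: Z_def)
    have Zc: "Z \<in> cliques V E" using Z(2) by (rule clique_mono) auto
    let ?I = "link (Q \<union> Z) \<inter> (part c j \<inter> good)"
    let ?X = "link Q \<inter> part c j \<inter> typical \<inter> link Z"
    have "link (Q \<union> Z) - ?I \<subseteq> link Z - part c j \<inter> good" by (auto simp: link_Un)
    then have "card (link (Q \<union> Z) - ?I) \<le> card (link Z - part c j \<inter> good)"
      by (rule card_mono[rotated]) auto
    also have "\<dots> \<le> s * K + b"
      using Y(3) by (intro card_link_outside_part) (auto simp: Z_def)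
    finally have B: "card (link (Q \<union> Z) - ?I) \<le> s * K + b" .
    have "real (card (link Q \<inter> part c j)) - \<delta> / 2 * real (card V) \<le> real (card ?X)"
      using Z Zc by (intro typical_available) (auto intro: card_clique_le simp: Z_def)
    moreover have "\<delta> * real (card V) \<le> real (card (link Q \<inter> part c j))"
      using Q(2) insert.prems by simp
    ultimately have "real (2 * 2 ^ (s * K + b)) < real (card ?X)"
      using large by simp
    then have X: "card ?X > 2 * 2 ^ (s * K + b)" by (simp only: of_nat_less_iff)
    \<comment> \<open>Only \<open>y\<close> has to be typical, \<open>z\<close> is merely good: one
      typical vertex per colour keeps the invariant alive.\<close>
    obtain y z where yz: "y \<in> ?X" "z \<in> ?I" "{y, z} \<in> E"
      by (rule adjacent_in_link[OF Z(2) _ _ B X]) (use typical_subset_good in \<open>auto simp: link_Un\<close>)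
    let ?Y = "insert z (insert y Z)"
    have y1: "insert y (Q \<union> Z) \<in> cliques V E"
      using yz by (intro insert_clique Z) (auto simp: link_Un)
    have "insert z (insert y (Q \<union> Z)) \<in> cliques V E"
      by (rule insert_clique[OF y1]) (use yz in \<open>auto simp: link_insert\<close>)
    then have "Q \<union> ?Y \<in> cliques V E" by (simp add: insert_commute)
    moreover have "?Y \<subseteq> good \<inter> link Q"
      using yz Z typical_subset_good by (auto simp: link_Un)
    moreover have "\<exists>w\<in>?Y. w \<in> typical \<and> c w = i" if "i \<in> I" for i
      using Y(3) that yz by (cases "i = j") (auto simp: Z_def part_def)
    moreover have "2 \<le> card {w \<in> ?Y. c w = i}" if "i \<in> insert j J" for i
    proof (cases "i = j")
      case True
      have "y \<noteq> z" using yz(3) edge_in_V by blast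
      moreover have "{w \<in> ?Y. c w = i} = {y, z}"
        using yz True by (auto simp: part_def Z_def)
      ultimately show ?thesis by simp
    next
      case False
      then have "{w \<in> ?Y. c w = i} = {w \<in> Y. c w = i}"
        using yz by (auto simp: part_def Z_def)
      then show ?thesis using that False Y(4) by auto
    qed
    ultimately show ?case by blast
  qed
  from this[OF finite_I] that show thesis by blast
qed

lemma card_ge_two_per_colour:
  assumes "Y \<subseteq> V" "\<And>i. i \<in> I \<Longrightarrow> 2 \<le> card {y \<in> Y. c y = i}"
  shows "2 * s \<le> card Y"
  using sum_mono[of I "\<lambda>_. 2" "\<lambda>i. card {y \<in> Y. c y = i}"] assms card_I
  by (simp add: card_eq_sum_colours[OF assms(1)])

text \<open>Otherwise, by the choice of \<open>c\<close>, the vertex has at least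
  \<open>\<delta> * card V\<close> neighbours in every part. Then a paired clique exists in its link
  and, together with \<open>v\<close>, has more than \<open>2 * s\<close> vertices.\<close>

lemma inside_less:
  assumes "v \<in> V"
  shows "real (inside c v) < \<delta> * real (card V)"
proof (rule ccontr)
  assume "\<not> ?thesis"
  then have *: "\<delta> * real (card V) \<le> real (card (link {v} \<inter> part c i))" if "i \<in> I" for i
    using max_cut[OF assms that] by linarith
  obtain Y where Y: "Y \<subseteq> good \<inter> link {v}" "{v} \<union> Y \<in> cliques V E"
    "\<And>i. i \<in> I \<Longrightarrow> 2 \<le> card {y \<in> Y. c y = i}"
    by (rule paired_clique[OF singleton_clique[OF assms] *]) auto
  have YV: "Y \<subseteq> V" using Y(1) link_subset by blast
  then have "2 * s \<le> card Y" using Y(3) by (rule card_ge_two_per_colour)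
  moreover have "v \<notin> Y" using Y(1) by (auto simp: link_verts_def)
  then have "card ({v} \<union> Y) = Suc (card Y)"
    using finite_subset[OF YV] by simp
  ultimately show False using card_clique_le[OF Y(2)] by simp
qed

lemma card_other_colours:
  assumes "Y \<subseteq> V" "\<And>i. i \<in> I \<Longrightarrow> card {y \<in> Y. c y = i} = 2" "j \<in> I"
  shows "card {y \<in> Y. c y \<noteq> j} + 2 = 2 * s"
proof -
  have finY: "finite Y" using assms(1) finite_V by (rule finite_subset)
  have "card Y = (\<Sum>i\<in>I. 2)"
    unfolding card_eq_sum_colours[OF assms(1)] using assms(2) by (intro sum.cong) auto
  moreover have "card Y = card ({y \<in> Y. c y \<noteq> j} \<union> {y \<in> Y. c y = j})"
    by (rule arg_cong[where f = card]) auto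
  moreover have "\<dots> = card {y \<in> Y. c y \<noteq> j} + card {y \<in> Y. c y = j}"
    by (rule card_Un_disjoint) (use finY in auto)
  ultimately show ?thesis using assms card_I by simp
qed

text \<open>All parts have at least \<open>\<delta> * card V\<close> vertices, so \<open>Q\<close>
  may be empty. No colour occurs more than twice, since cliques have at most \<open>2 * s\<close>
  vertices.\<close>

lemma exists_paired_clique:
  obtains Y where "Y \<subseteq> good" "Y \<in> cliques V E"
    "\<And>i. i \<in> I \<Longrightarrow> \<exists>y\<in>Y. y \<in> typical \<and> c y = i"
    "\<And>i. i \<in> I \<Longrightarrow> card {y \<in> Y. c y = i} = 2"
proof -
  have "\<delta> * real (card V) \<le> real (card (link {} \<inter> part c i))" if "i \<in> I" for i
  proof -
    have "\<delta> \<le> 1 / (2 * real s)" using \<delta>_le \<delta>_pos s_pos by (simp add: field_simps)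
    then have "\<delta> * real (card V) \<le> 1 / (2 * real s) * real (card V)"
      by (intro mult_right_mono) auto
    moreover have "link {} \<inter> part c i = part c i" by (auto simp: part_def)
    ultimately show ?thesis using part_ge[OF that] by simp
  qed
  then obtain Y where Y: "Y \<subseteq> good \<inter> link {}" "{} \<union> Y \<in> cliques V E"
    "\<And>i. i \<in> I \<Longrightarrow> \<exists>y\<in>Y. y \<in> typical \<and> c y = i"
    "\<And>i. i \<in> I \<Longrightarrow> 2 \<le> card {y \<in> Y. c y = i}"
    by (rule paired_clique[OF empty_clique]) auto
  have "card {y \<in> Y. c y = i} = 2" if "i \<in> I" for i
  proof (rule ccontr)
    assume "card {y \<in> Y. c y = i} \<noteq> 2"
    then have "(\<Sum>i\<in>I. 2) < (\<Sum>i\<in>I. card {y \<in> Y. c y = i})"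
      using Y(4) that finite_I by (intro sum_strict_mono_ex1) (auto intro!: bexI[of _ i] le_neq_trans)
    then have "2 * s < card Y" using card_eq_sum_colours[of Y] Y(1) card_I by auto
    then show False using card_clique_le[of Y] Y(2) by simp
  qed
  then show thesis using that Y by auto
qed

text \<open>The link of the \<open>2s - 2\<close> vertices of a paired clique outside colour \<open>j\<close> is 2-regular, and up
  to boundedly many vertices it is contained in part \<open>j\<close>.\<close>

lemma many_inside_pairs:
  assumes "j \<in> I"
  obtains G where "G \<subseteq> part c j \<inter> good" "\<And>y. y \<in> G \<Longrightarrow> card {z \<in> G. {y, z} \<in> E} \<le> 2"
    "real (card V) / (4 * real s) \<le> real (\<Sum>y\<in>G. card {z \<in> G. {y, z} \<in> E})"
proof -
  obtain Y where Y: "Y \<subseteq> good" "Y \<in> cliques V E"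
    "\<And>i. i \<in> I \<Longrightarrow> \<exists>y\<in>Y. y \<in> typical \<and> c y = i"
    "\<And>i. i \<in> I \<Longrightarrow> card {y \<in> Y. c y = i} = 2" using exists_paired_clique by blast
  define T where "T = {y \<in> Y. c y \<noteq> j}"
  have T: "T \<in> cliques V E" by (rule clique_mono[OF Y(2)]) (auto simp: T_def)
  have cT: "card T + 2 = 2 * s"
    unfolding T_def using Y good_subset_V assms by (intro card_other_colours) auto
  let ?H = "link T" and ?B = "s * K + b"
  let ?G = "?H \<inter> (part c j \<inter> good)"
  have reg: "card {u \<in> ?H. {u, v} \<in> E} = 2" if "v \<in> ?H" for v
    by (rule card_link_pair[OF T cT that])
  have "card (?H - part c j \<inter> good) \<le> ?B"
    using Y(3) by (intro card_link_outside_part) (auto simp: T_def)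
  moreover have "?H - part c j \<inter> good = ?H - ?G" by auto
  ultimately have B: "card (?H - ?G) \<le> ?B" by simp
  have split: "card {z \<in> ?G. {y, z} \<in> E} + card {z \<in> ?H - ?G. {y, z} \<in> E} = 2" if "y \<in> ?G" for y
  proof -
    have "card {z \<in> ?G. {y, z} \<in> E} + card {z \<in> ?H - ?G. {y, z} \<in> E}
        = card ({z \<in> ?G. {y, z} \<in> E} \<union> {z \<in> ?H - ?G. {y, z} \<in> E})"
      by (rule card_Un_disjoint[symmetric]) auto
    also have "{z \<in> ?G. {y, z} \<in> E} \<union> {z \<in> ?H - ?G. {y, z} \<in> E} = {u \<in> ?H. {u, y} \<in> E}"
      by (auto simp: insert_commute)
    finally show ?thesis using reg that by simp
  qed
  \<comment> \<open>Edges that leave \<open>?G\<close> inside the link are counted from their ends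
    outside \<open>?G\<close>; there are few such ends, each of degree 2.\<close>
  have "(\<Sum>y\<in>?G. card {z \<in> ?H - ?G. {y, z} \<in> E}) = (\<Sum>y\<in>?G. \<Sum>z | z \<in> ?H - ?G \<and> {y, z} \<in> E. 1)"
    by simp
  also have "\<dots> = (\<Sum>z\<in>?H - ?G. \<Sum>y | y \<in> ?G \<and> {y, z} \<in> E. 1)"
    by (rule sum.swap_restrict) auto
  also have "\<dots> = (\<Sum>z\<in>?H - ?G. card {y \<in> ?G. {y, z} \<in> E})" by simp
  also have "\<dots> \<le> (\<Sum>z\<in>?H - ?G. 2)"
  proof (rule sum_mono)
    fix z assume "z \<in> ?H - ?G"
    then have "card {u \<in> ?H. {u, z} \<in> E} = 2" using reg by simp
    moreover have "card {y \<in> ?G. {y, z} \<in> E} \<le> card {u \<in> ?H. {u, z} \<in> E}"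
      by (rule card_mono) auto
    ultimately show "card {y \<in> ?G. {y, z} \<in> E} \<le> 2" by simp
  qed
  also have "\<dots> \<le> 2 * ?B" using B by simp
  finally have out: "(\<Sum>y\<in>?G. card {z \<in> ?H - ?G. {y, z} \<in> E}) \<le> 2 * ?B" .
  have "(\<Sum>y\<in>?G. card {z \<in> ?G. {y, z} \<in> E} + card {z \<in> ?H - ?G. {y, z} \<in> E}) = (\<Sum>y\<in>?G. 2)"
    by (rule sum.cong[OF refl split])
  then have tot: "2 * card ?G \<le> (\<Sum>y\<in>?G. card {z \<in> ?G. {y, z} \<in> E}) + 2 * ?B"
    using out by (simp add: sum.distrib)
  have "real (card (part c j)) - \<delta> / 2 * real (card V) \<le> real (card (part c j \<inter> typical \<inter> ?H))"
    using Y(1) T by (intro typical_available) (auto simp: T_def intro: card_clique_le[OF T[unfolded T_def]])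
  also have "\<dots> \<le> real (card ?G)"
    using typical_subset_good by (intro of_nat_mono card_mono) auto
  finally have G1: "real (card V) / (2 * real s) - \<delta> / 2 * real (card V) \<le> real (card ?G)"
    using part_ge[OF assms] by linarith
  have "\<delta> \<le> 1 / (4 * real s)" using \<delta>_le \<delta>_pos s_pos by (simp add: field_simps)
  then have "\<delta> * real (card V) \<le> 1 / (4 * real s) * real (card V)"
    by (intro mult_right_mono) auto
  then have \<delta>n: "\<delta> * real (card V) \<le> real (card V) / (4 * real s)" by simp
  have half: "real (card V) / (2 * real s) = real (card V) / (4 * real s) + real (card V) / (4 * real s)"
    by simp
  \<comment> \<open>This lets \<open>large\<close> absorb the linear loss \<open>2 * ?B\<close> as
    well.\<close>
  have "real ?B < 2 ^ ?B" by (rule of_nat_less_two_power)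
  then have "2 * real ?B < 2 * 2 ^ ?B" by (rule mult_strict_left_mono) simp
  then have "2 * real ?B < \<delta> / 2 * real (card V)" using large by (rule less_trans)
  then have "2 * real ?B \<le> real (card ?G)" "real (card V) / (4 * real s) \<le> real (card ?G)"
    using G1 \<delta>n half \<delta>_pos by (auto simp: field_simps)
  moreover have "2 * real (card ?G) \<le> real (\<Sum>y\<in>?G. card {z \<in> ?G. {y, z} \<in> E}) + 2 * real ?B"
    using tot by linarith
  ultimately have "real (card V) / (4 * real s) \<le> real (\<Sum>y\<in>?G. card {z \<in> ?G. {y, z} \<in> E})"
    by linarith
  moreover have "card {z \<in> ?G. {y, z} \<in> E} \<le> 2" if "y \<in> ?G" for y
    using split[OF that] by linarith
  ultimately show thesis using that[of ?G] by auto
qed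

section \<open>Paired cliques with few missing pairs\<close>

abbreviation total_missing :: real where
  "total_missing \<equiv> \<Sum>v\<in>V. real (missing c v)"

text \<open>A weighted count over the adjacent pairs of a set \<open>G\<close> in part
  \<open>j\<close> that is chosen without regard to \<open>Y\<close>. If no pair were light, each
  would have weight at least 1, but the total weight is too small for the number of pairs.\<close>

lemma light_pair:
  assumes "j \<in> I" and Y: "Y \<subseteq> good" "Y \<in> cliques V E" "\<And>y. y \<in> Y \<Longrightarrow> c y \<noteq> j"
  obtains y z where "y \<in> part c j \<inter> good \<inter> link Y" "z \<in> part c j \<inter> good \<inter> link Y" "{y, z} \<in> E"
    "real (missing c y) + real (missing c z) \<le> 32 * real s * total_missing / real (card V)"
proof (rule ccontr)
  assume "\<not> thesis"
  then have no: "\<And>y z. y \<in> part c j \<inter> good \<inter> link Y \<Longrightarrow> z \<in> part c j \<inter> good \<inter> link Y \<Longrightarrow> {y, z} \<in> E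
      \<Longrightarrow> 32 * real s * total_missing / real (card V) < real (missing c y) + real (missing c z)"
    using that by (meson not_le)
  let ?n = "real (card V)" and ?M = total_missing
  have npos: "?n > 0" and spos: "real s > 0" using V_nonempty s_pos by auto
  obtain G where G: "G \<subseteq> part c j \<inter> good" "\<And>y. y \<in> G \<Longrightarrow> card {z \<in> G. {y, z} \<in> E} \<le> 2"
    "?n / (4 * real s) \<le> real (\<Sum>y\<in>G. card {z \<in> G. {y, z} \<in> E})"
    using many_inside_pairs[OF \<open>j \<in> I\<close>] by blast
  have finG: "finite G" using G(1) by (rule finite_subset) auto
  \<comment> \<open>The first summand measures \<open>missing\<close> in units of the claimed
    threshold, the second penalises vertices outside \<open>link Y\<close>. If
    \<open>total_missing\<close> is 0, the quotient is 0 by convention.\<close>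
  define w where "w v = real (missing c v) * ?n / (32 * real s * ?M) + of_bool (v \<notin> link Y)" for v
  have M0: "?M \<ge> 0" by (simp add: sum_nonneg)
  have w0: "w v \<ge> 0" for v using M0 by (simp add: w_def)
  have miss_le: "real (missing c v) \<le> ?M" if "v \<in> V" for v
    using that by (intro member_le_sum) auto
  have GV: "G \<subseteq> V" using G(1) good_subset_V by auto
  have heavy: "1 \<le> w y + w z" if yz: "y \<in> G" "z \<in> G" "{y, z} \<in> E" for y z
  proof (cases "y \<in> link Y \<and> z \<in> link Y")
    case False
    then show ?thesis using M0 by (auto simp: w_def)
  next
    case True
    then have h: "32 * real s * ?M / ?n < real (missing c y) + real (missing c z)"
      using no[of y z] yz G(1) by blast
    have "y \<in> V" "z \<in> V" using yz GV by auto
    then have le: "real (missing c y) \<le> ?M" "real (missing c z) \<le> ?M" using miss_le by auto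
    have "?M \<noteq> 0"
    proof
      assume "?M = 0"
      then show False using h le by simp
    qed
    then have "?M > 0" using M0 by linarith
    then have "1 \<le> (real (missing c y) + real (missing c z)) * ?n / (32 * real s * ?M)"
      using h npos spos by (simp add: field_simps)
    then show ?thesis using True by (simp add: w_def add_divide_distrib distrib_right)
  qed
  have "real (\<Sum>y\<in>G. card {z \<in> G. {y, z} \<in> E}) = (\<Sum>y\<in>G. \<Sum>z | z \<in> G \<and> {y, z} \<in> E. 1)"
    by simp
  also have "\<dots> \<le> (\<Sum>y\<in>G. \<Sum>z | z \<in> G \<and> {y, z} \<in> E. w y + w z)"
    using heavy by (intro sum_mono) auto
  also have "\<dots> \<le> 4 * sum w G"
    using finG G(2) w0 by (rule sum_adjacent_pairs_le)
  also have "sum w G = (\<Sum>v\<in>G. real (missing c v)) * ?n / (32 * real s * ?M) + real (card (G - link Y))"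
  proof -
    have "G \<inter> {v. v \<notin> link Y} = G - link Y" by auto
    then show ?thesis
      using finG by (simp add: w_def sum.distrib sum_divide_distrib sum_distrib_right)
  qed
  also have "(\<Sum>v\<in>G. real (missing c v)) * ?n / (32 * real s * ?M) \<le> ?n / (32 * real s)"
  proof (cases "?M = 0")
    case True
    then show ?thesis by simp
  next
    case False
    then have "?M > 0" using M0 by simp
    moreover have "(\<Sum>v\<in>G. real (missing c v)) \<le> ?M"
      using GV by (intro sum_mono2) auto
    then have "(\<Sum>v\<in>G. real (missing c v)) * ?n \<le> ?M * ?n" by (intro mult_right_mono) auto
    ultimately show ?thesis using spos by (simp add: field_simps)
  qed
  also have "real (card (G - link Y)) \<le> \<delta> / 2 * ?n"
  proof -
    have "real (card G) - \<delta> / 2 * ?n \<le> real (card (G \<inter> typical \<inter> link Y))"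
      using Y G(1) card_clique_le by (intro typical_available) auto
    also have "\<dots> \<le> real (card (G \<inter> link Y))"
      using finG by (intro of_nat_mono card_mono) auto
    finally show ?thesis
      using card_Diff_subset_Int[of G "link Y"] finG card_mono[OF finG, of "G \<inter> link Y"]
      by (simp add: of_nat_diff)
  qed
  \<comment> \<open>The two terms are four times \<open>?n / (32 * s)\<close> and four times
    \<open>\<delta> / 2 * ?n\<close>.\<close>
  finally have "?n / (4 * real s) \<le> ?n / (8 * real s) + 2 * \<delta> * ?n"
    using G(3) by (simp add: algebra_simps)
  then have "?n * 1 \<le> ?n * (16 * real s * \<delta>)" using spos by (simp add: field_simps)
  then have "1 \<le> 16 * real s * \<delta>" using npos by (simp only: mult_le_cancel_left_pos)
  then show False using \<delta>_le by simp
qed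

lemma light_paired_clique:
  assumes "J \<subseteq> I"
  shows "\<exists>Y. Y \<subseteq> good \<and> Y \<in> cliques V E \<and> c ` Y \<subseteq> J \<and> (\<forall>i\<in>J. card {y \<in> Y. c y = i} = 2) \<and>
    (\<Sum>y\<in>Y. real (missing c y)) \<le> real (card J) * (32 * real s * total_missing / real (card V))"
proof -
  have "finite J" using assms finite_I by (rule finite_subset)
  then show ?thesis using assms
  proof (induction J)
    case empty
    then show ?case by (intro exI[of _ "{}"]) auto
  next
    case (insert j J)
    then obtain Y where Y: "Y \<subseteq> good" "Y \<in> cliques V E" "c ` Y \<subseteq> J"
      "\<forall>i\<in>J. card {y \<in> Y. c y = i} = 2"
      "(\<Sum>y\<in>Y. real (missing c y)) \<le> real (card J) * (32 * real s * total_missing / real (card V))"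
      by auto
    have notj: "c y \<noteq> j" if "y \<in> Y" for y using that Y(3) insert.hyps by auto
    obtain y z where yz: "y \<in> part c j \<inter> good \<inter> link Y" "z \<in> part c j \<inter> good \<inter> link Y"
      "{y, z} \<in> E"
      "real (missing c y) + real (missing c z) \<le> 32 * real s * total_missing / real (card V)"
      using light_pair[OF _ Y(1,2) notj] insert.prems by auto
    have new: "y \<notin> Y" "z \<notin> Y" "y \<noteq> z" using yz link_not_mem edge_in_V by blast+
    have cz: "c y = j" "c z = j" using yz by (auto simp: part_def)
    let ?Y = "insert z (insert y Y)"
    have y1: "insert y Y \<in> cliques V E" using yz by (intro insert_clique Y) auto
    have "?Y \<in> cliques V E" by (rule insert_clique[OF y1]) (use yz in \<open>auto simp: link_insert\<close>)
    moreover have "card {w \<in> ?Y. c w = i} = 2" if "i \<in> insert j J" for i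
    proof (cases "i = j")
      case True
      then have "{w \<in> ?Y. c w = i} = {y, z}" using cz notj by auto
      then show ?thesis using new by simp
    next
      case False
      then have "{w \<in> ?Y. c w = i} = {w \<in> Y. c w = i}" using cz by auto
      then show ?thesis using that False Y(4) by auto
    qed
    moreover have "(\<Sum>w\<in>?Y. real (missing c w))
        \<le> real (card (insert j J)) * (32 * real s * total_missing / real (card V))"
      using Y(5) yz(4) new insert.hyps finite_clique[OF Y(2)] by (simp add: algebra_simps add_divide_distrib)
    moreover have "?Y \<subseteq> good" "c ` ?Y \<subseteq> insert j J" using Y yz cz by auto
    ultimately show ?case by blast
  qed
qed

section \<open>Bounding the monochromatic edges\<close>

text \<open>A vertex of the part in \<open>link T\<close> has only two neighbours in the link, so
  its other neighbours in the part lie in \<open>part c j - link T\<close>. The edges between the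
  two sets are charged to the ends outside the link, hence the factor 2.\<close>

lemma sum_inside_part_le:
  assumes T: "T \<in> cliques V E" "card T + 2 = 2 * s"
  shows "(\<Sum>v\<in>part c j. inside c v)
    \<le> 2 * card (part c j) + 2 * (\<Sum>v\<in>part c j - link T. inside c v)"
proof -
  let ?H = "part c j \<inter> link T" and ?D = "part c j - link T"
  have "inside c v \<le> 2 + card {u \<in> ?D. {u, v} \<in> E}" if "v \<in> ?H" for v
  proof -
    have "inside c v \<le> card ({u \<in> link T. {u, v} \<in> E} \<union> {u \<in> ?D. {u, v} \<in> E})"
      unfolding inside_def using that by (intro card_mono) (auto simp: part_def)
    also have "\<dots> \<le> card {u \<in> link T. {u, v} \<in> E} + card {u \<in> ?D. {u, v} \<in> E}"
      by (rule card_Un_le)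
    finally show ?thesis using card_link_pair[OF T] that by simp
  qed
  then have "(\<Sum>v\<in>?H. inside c v) \<le> (\<Sum>v\<in>?H. 2 + card {u \<in> ?D. {u, v} \<in> E})"
    by (rule sum_mono)
  also have "\<dots> = 2 * card ?H + (\<Sum>v\<in>?H. \<Sum>u | u \<in> ?D \<and> {u, v} \<in> E. 1)"
    by (simp only: sum.distrib) simp
  also have "(\<Sum>v\<in>?H. \<Sum>u | u \<in> ?D \<and> {u, v} \<in> E. 1) = (\<Sum>u\<in>?D. \<Sum>v | v \<in> ?H \<and> {u, v} \<in> E. 1::nat)"
    by (rule sum.swap_restrict) auto
  also have "\<dots> = (\<Sum>u\<in>?D. card {v \<in> ?H. {u, v} \<in> E})" by simp
  also have "\<dots> \<le> (\<Sum>u\<in>?D. inside c u)"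
    unfolding inside_def by (intro sum_mono card_mono) (auto simp: part_def insert_commute)
  finally have "(\<Sum>v\<in>?H. inside c v) \<le> 2 * card ?H + (\<Sum>u\<in>?D. inside c u)" by simp
  moreover have "(\<Sum>v\<in>part c j. inside c v) = (\<Sum>v\<in>?H. inside c v) + (\<Sum>v\<in>?D. inside c v)"
    by (rule sum.Int_Diff) simp
  moreover have "card ?H \<le> card (part c j)" by (rule card_mono) auto
  ultimately show ?thesis by linarith
qed

text \<open>For a light paired clique, each part has at most
  \<open>32 * s ^ 2 * total_missing / card V\<close> vertices outside the link, each of
  monochromatic degree below \<open>\<delta> * card V\<close>. Doubled and summed over the
  \<open>s\<close> parts, this gives \<open>64 * s ^ 3 * \<delta> = 1\<close> times
  \<open>total_missing\<close>.\<close>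

lemma sum_inside_le: "(\<Sum>v\<in>V. real (inside c v)) \<le> 2 * real (card V) + total_missing"
proof -
  let ?n = "real (card V)" and ?M = total_missing
  have npos: "?n > 0" using V_nonempty by simp
  obtain Y where Y: "Y \<subseteq> good" "Y \<in> cliques V E" "\<forall>i\<in>I. card {y \<in> Y. c y = i} = 2"
    "(\<Sum>y\<in>Y. real (missing c y)) \<le> real s * (32 * real s * ?M / ?n)"
    using light_paired_clique[of I] card_I by auto
  have part: "(\<Sum>v\<in>part c j. real (inside c v)) \<le> 2 * real (card (part c j)) + 64 * real s ^ 2 * \<delta> * ?M"
    if "j \<in> I" for j
  proof -
    define T where "T = {y \<in> Y. c y \<noteq> j}"
    have T: "T \<in> cliques V E" by (rule clique_mono[OF Y(2)]) (auto simp: T_def)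
    have cT: "card T + 2 = 2 * s"
      unfolding T_def using Y good_subset_V that by (intro card_other_colours) auto
    let ?D = "part c j - link T"
    have "card ?D \<le> (\<Sum>y\<in>T. missing c y)"
      by (rule card_part_diff_link_le[OF finite_clique[OF T]]) (simp add: T_def)
    also have "\<dots> \<le> (\<Sum>y\<in>Y. missing c y)"
      using finite_clique[OF Y(2)] by (intro sum_mono2) (auto simp: T_def)
    finally have "real (card ?D) \<le> (\<Sum>y\<in>Y. real (missing c y))"
      by (simp flip: of_nat_sum)
    then have D: "real (card ?D) \<le> real s * (32 * real s * ?M / ?n)" using Y(4) by linarith
    have "(\<Sum>v\<in>?D. real (inside c v)) \<le> (\<Sum>v\<in>?D. \<delta> * ?n)"
      using inside_less by (intro sum_mono less_imp_le) (auto simp: part_def)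
    also have "\<dots> = real (card ?D) * (\<delta> * ?n)" by simp
    also have "\<dots> \<le> (real s * (32 * real s * ?M / ?n)) * (\<delta> * ?n)"
      using D \<delta>_pos by (intro mult_right_mono) auto
    also have "\<dots> = 32 * real s ^ 2 * \<delta> * ?M" using npos by (simp add: power2_eq_square)
    finally have "(\<Sum>v\<in>?D. real (inside c v)) \<le> 32 * real s ^ 2 * \<delta> * ?M" .
    moreover have "real (\<Sum>v\<in>part c j. inside c v)
        \<le> real (2 * card (part c j) + 2 * (\<Sum>v\<in>?D. inside c v))"
      using sum_inside_part_le[OF T cT, of j] by (simp only: of_nat_le_iff)
    ultimately show ?thesis by simp
  qed
  have col: "\<forall>v\<in>V. c v \<in> I" using colour by blast
  have "(\<Sum>v\<in>V. real (inside c v)) = (\<Sum>j\<in>I. \<Sum>v\<in>part c j. real (inside c v))"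
    by (rule sum_over_parts[OF finite_I col, symmetric])
  also have "\<dots> \<le> (\<Sum>j\<in>I. 2 * real (card (part c j)) + 64 * real s ^ 2 * \<delta> * ?M)"
    using part by (rule sum_mono)
  also have "\<dots> = 2 * real (\<Sum>j\<in>I. card (part c j)) + (64 * real s ^ 3 * \<delta>) * ?M"
    by (simp add: sum.distrib sum_distrib_left card_I power2_eq_square power3_eq_cube mult_ac)
  also have "\<dots> = 2 * ?n + ?M" by (simp only: sum_card_part[OF finite_I col] \<delta>)
  finally show ?thesis .
qed

end

section \<open>The edge bound\<close>

theorem theorem1p5:
  fixes s :: nat and C :: real
  assumes "s \<ge> 1" and "C > 0"
  shows "\<exists>n\<^sub>0 :: nat. \<forall>(V :: 'a set) (E :: 'a set set).
           fin_simple_graph V E \<longrightarrow>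
           leveled (2 * s - 1) V E \<longrightarrow>
           card V \<ge> n\<^sub>0 \<longrightarrow>
           real (num_cliques (s + 1) V E) \<le> C * real (card V) ^ s \<longrightarrow>
           real (card E) \<le> (real s - 1) / (2 * real s) * real (card V) ^ 2 + real (card V)"
proof -
  \<comment> \<open>\<open>D\<close> is the constant of \<open>near_turan_colouring\<close>. As the
    defects will sum to at most \<open>2 * D * card V\<close>, Markov's inequality dictates
    \<open>b\<close> and \<open>K\<close>. The summands of \<open>n0\<close> give
    \<open>card V > 0\<close>, \<open>K_le\<close>, the hypothesis of \<open>card_part_ge\<close>
    and \<open>large\<close>; the summand 1 makes the last one strict.\<close>
  define D where "D = 3 * real s * (real s + 1) * real s ^ (2 * s) * C"
  define \<delta> where "\<delta> = 1 / (64 * real s ^ 3)"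
  define \<epsilon> where "\<epsilon> = \<delta> / (8 * real s)"
  define b where "b = nat \<lceil>2 * D / \<epsilon>\<rceil>"
  define K where "K = nat \<lceil>8 * D / \<delta>\<rceil>"
  define n0 where "n0 = nat \<lceil>1 + real K / \<epsilon> + 4 * real s ^ 2 * D + 4 * 2 ^ (s * K + b) / \<delta>\<rceil>"
  have pos: "real s > 0" "D > 0" "\<delta> > 0" "\<epsilon> > 0"
    using assms by (simp_all add: D_def \<delta>_def \<epsilon>_def)
  have b: "2 * D / \<epsilon> \<le> real b" and K: "8 * D / \<delta> \<le> real K"
    by (simp_all only: b_def K_def real_nat_ceiling_ge)
  have Kpos: "real K > 0" using K pos by (meson divide_pos_pos less_le_trans mult_pos_pos zero_less_numeral)
  show ?thesis
  proof (intro exI[of _ n0] allI impI)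
    fix V :: "'a set" and E :: "'a set set"
    assume graph: "fin_simple_graph V E" and leveled: "leveled (2 * s - 1) V E"
      and n: "n0 \<le> card V" and few: "real (num_cliques (s + 1) V E) \<le> C * real (card V) ^ s"
    interpret leveled_graph V E s
      using graph leveled \<open>s \<ge> 1\<close> by unfold_locales
    let ?n = "real (card V)"
    have "1 + real K / \<epsilon> + 4 * real s ^ 2 * D + 4 * 2 ^ (s * K + b) / \<delta> \<le> real n0"
      by (simp only: n0_def real_nat_ceiling_ge)
    then have sum: "1 + real K / \<epsilon> + 4 * real s ^ 2 * D + 4 * 2 ^ (s * K + b) / \<delta> \<le> ?n"
      using n by linarith
    moreover have "0 \<le> real K / \<epsilon>" "0 \<le> 4 * real s ^ 2 * D" "0 \<le> 4 * 2 ^ (s * K + b) / \<delta>"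
      using pos by auto
    ultimately have n1: "?n > 0" "real K / \<epsilon> \<le> ?n" "4 * real s ^ 2 * D \<le> ?n"
      "4 * 2 ^ (s * K + b) / \<delta> < ?n" by linarith+
    show "real (card E) \<le> (real s - 1) / (2 * real s) * ?n ^ 2 + ?n"
    proof (cases "(real s - 1) * ?n ^ 2 \<le> 2 * real s * real (card E)")
      case False
      then have "real (card E) \<le> (real s - 1) / (2 * real s) * ?n ^ 2"
        using pos by (simp add: field_simps)
      then show ?thesis by simp
    next
      case dense: True
      have few': "real (card (rcliques (s + 1))) \<le> C * ?n ^ s"
        using few by (simp add: num_cliques_def rcliques_def)
      have "V \<noteq> {}" using n1 by auto
      obtain I :: "'a set" and c0 :: "'a \<Rightarrow> 'a" where I: "finite I" "card I = s" and c0: "\<forall>v\<in>V. c0 v \<in> I"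
        "real (\<Sum>v\<in>V. inside c0 v) \<le> D * ?n"
        using near_turan_colouring[OF \<open>s \<ge> 1\<close> \<open>V \<noteq> {}\<close> dense few'] unfolding D_def by blast
      obtain c where c: "\<forall>v\<in>V. c v \<in> I" "(\<Sum>v\<in>V. inside c v) \<le> (\<Sum>v\<in>V. inside c0 v)"
        "\<And>v i. v \<in> V \<Longrightarrow> i \<in> I \<Longrightarrow> inside c v \<le> card (link {v} \<inter> part c i)"
        using max_cut_colouring[OF c0(1)] by blast
      have inside: "real (\<Sum>v\<in>V. inside c v) \<le> D * ?n" using c(2) c0(2) by linarith
      have "real (2 * card E + (\<Sum>v\<in>V. missing c v) + (\<Sum>i\<in>I. (card (part c i))\<^sup>2))
          = real ((\<Sum>v\<in>V. inside c v) + (card V)\<^sup>2)"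
        using edge_count[OF I(1) c(1)] by simp
      then have count: "2 * real (card E) + (\<Sum>v\<in>V. real (missing c v)) + (\<Sum>i\<in>I. (real (card (part c i)))\<^sup>2)
          = (\<Sum>v\<in>V. real (inside c v)) + ?n\<^sup>2"
        by simp
      have squares: "?n\<^sup>2 / real s \<le> (\<Sum>i\<in>I. (real (card (part c i)))\<^sup>2)"
        using card_V_sq_le[OF I(1) c(1)] I(2) pos by (simp add: field_simps)
      have dense': "?n\<^sup>2 - ?n\<^sup>2 / real s \<le> 2 * real (card E)"
        using dense pos by (simp add: field_simps)
      \<comment> \<open>At this density the edge count shows that the missing pairs are at most as
        many as the monochromatic edges.\<close>
      have "(\<Sum>v\<in>V. real (missing c v)) \<le> D * ?n"
        using count squares dense' inside by simp
      then have defect: "(\<Sum>v\<in>V. real (inside c v + missing c v)) \<le> 2 * D * ?n"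
        using inside by (simp add: sum.distrib)
      have markov: "real (card {v \<in> V. real (inside c v + missing c v) > t}) * t \<le> 2 * D * ?n" for t
      proof -
        have "real (card {v \<in> V. real (inside c v + missing c v) > t}) * t
            \<le> (\<Sum>v | v \<in> V \<and> real (inside c v + missing c v) > t. real (inside c v + missing c v))"
          by (rule sum_bounded_below) auto
        also have "\<dots> \<le> (\<Sum>v\<in>V. real (inside c v + missing c v))"
          by (intro sum_mono2) auto
        finally show ?thesis using defect by linarith
      qed
      interpret coloured_leveled_graph V E s I c \<delta> \<epsilon> K b
      proof
        show "finite I" "card I = s" by fact+
        show "c v \<in> I" if "v \<in> V" for v using c(1) that by blast
        show "inside c v \<le> card (link {v} \<inter> part c i)" if "v \<in> V" "i \<in> I" for v i
          using that by (rule c(3))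
        show "?n / (2 * real s) \<le> real (card (part c i))" if "i \<in> I" for i
          by (rule card_part_ge[OF I(1) c(1) I(2) \<open>s \<ge> 1\<close> dense inside n1(3) that])
        show "card {v \<in> V. real (inside c v + missing c v) > \<epsilon> * ?n} \<le> b"
        proof -
          have "real (card {v \<in> V. real (inside c v + missing c v) > \<epsilon> * ?n}) \<le> 2 * D / \<epsilon>"
            using markov[of "\<epsilon> * ?n"] pos n1(1) by (simp add: field_simps)
          then show ?thesis using b by linarith
        qed
        show "real (card {v \<in> V. inside c v + missing c v > K}) \<le> \<delta> / 4 * ?n"
        proof -
          let ?x = "real (card {v \<in> V. inside c v + missing c v > K})"
          have "?x * real K \<le> 2 * D * ?n" using markov[of "real K"] by (simp only: of_nat_less_iff)
          moreover have "?x * (8 * D / \<delta>) \<le> ?x * real K" using K by (intro mult_left_mono) auto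
          ultimately have "?x * (8 * D / \<delta>) \<le> 2 * D * ?n" by linarith
          then have "(2 * D) * (?x * 4) \<le> (2 * D) * (\<delta> * ?n)" using pos by (simp add: field_simps)
          then have "?x * 4 \<le> \<delta> * ?n" using pos by (subst (asm) mult_le_cancel_left_pos) auto
          then show ?thesis by simp
        qed
        show "64 * real s ^ 3 * \<delta> = 1" using pos by (simp add: \<delta>_def)
        show "8 * real s * \<epsilon> \<le> \<delta>" using pos by (simp add: \<epsilon>_def)
        show "real K \<le> \<epsilon> * ?n" using n1(2) pos by (simp add: field_simps)
        show "2 * 2 ^ (s * K + b) < \<delta> / 2 * ?n" using n1(4) pos by (simp add: field_simps)
      qed
      \<comment> \<open>In the edge count \<open>total_missing\<close> cancels against the excess in
        \<open>sum_inside_le\<close>, leaving \<open>2 * ?n\<close>.\<close>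
      have "2 * real (card E) \<le> 2 * ?n + ?n\<^sup>2 - ?n\<^sup>2 / real s"
        using count squares sum_inside_le by linarith
      also have "\<dots> = 2 * ((real s - 1) / (2 * real s) * ?n\<^sup>2 + ?n)"
        using pos by (simp add: field_simps)
      finally show ?thesis by (rule mult_left_le_imp_le) simp
    qed
  qed
qed

end
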